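(* Let $R>1$ and let $\Sigma\subset B_1(0)\subset\mathbb{R}^2$ be an arbitrary core whose boundary $\Gamma=\partial\Sigma$ is a curve of class $C^2$. Let $A:\mathbb{R}^2\to\mathbb{R}$ be given by $A=+1$ outside $B_R(0)$, $A=-1$ in $B_R(0)\setminus\Sigma$, $A=+1$ in $\Sigma$. Then, for every radius $q$ with $R<q<R^*:=R^{3/2}$, there exists a source $f=F\,\mathcal{H}^1\lfloor\partial B_q(0)$, with $F:\partial B_q(0)\to\mathbb{R}$, $F\in L^2(\partial B_q(0))$ and $\int_{\partial B_q(0)}F\,d\mathcal{H}^1=0$, such that the configuration given by $A$ and $f$ is resonant, i.e. $\limsup_{\eta\to0}E_\eta(u_\eta)=\infty$.
   Context: $B_r(x_0)$ is the disk of radius $r$ centered at $x_0$ in $\mathbb{R}^2$; $\mathcal{H}^1\lfloor\Gamma$ is one-dimensional Hausdorff measure restricted to the curve $\Gamma$, so that $f$ acts on test functions by $\langle f,\varphi\rangle=\int_{\partial B_q(0)}F\varphi\,d\mathcal{H}^1$. $\dot H^1(\mathbb{R}^2)=\{U\in L^2_{\mathrm{loc}}(\mathbb{R}^2): \nabla U\in L^2(\mathbb{R}^2)\}$ (real- or complex-valued functions). For $\eta>0$ set $a_\eta(x)=A(x)+i\eta$, and let $u_\eta\in\dot H^1(\mathbb{R}^2)$ be the complex-valued weak solution, unique up to an additive constant, of $\nabla\cdot(a_\eta\nabla u_\eta)=f$ on $\mathbb{R}^2$ (with $\nabla u_\eta\to0$ as $|x|\to\infty$). The energy is $E_\eta(u_\eta)=\frac{\eta}{2}\int_{\mathbb{R}^2}|\nabla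 u_\eta|^2\,dx$, and a configuration (coefficient $A$ and source $f$) is called resonant if $\limsup_{\eta\to0}E_\eta(u_\eta)=\infty$, and non-resonant otherwise. *)

theory Defs
  imports "HOL-Analysis.Analysis"
begin

section \<open>One-dimensional Hausdorff measure\<close>

definition hausdorff1_pre :: "real \<Rightarrow> 'a::metric_space set \<Rightarrow> ennreal" where
  "hausdorff1_pre \<delta> S =
     (INF C \<in> {C :: nat \<Rightarrow> 'a set. S \<subseteq> (\<Union>i. C i) \<and> (\<forall>i. bounded (C i) \<and> diameter (C i) \<le> \<delta>)}.
        \<Sum>i. ennreal (diameter (C i)))"

definition hausdorff1_outer :: "'a::metric_space set \<Rightarrow> ennreal" where
  "hausdorff1_outer S = (SUP \<delta>\<in>{0<..}. hausdorff1_pre \<delta> S)"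

text \<open>No normalizing factor is needed in dimension one. The outer measure is a metric outer
  measure, hence countably additive on the Borel sets.\<close>

definition hausdorff1 :: "'a::metric_space measure" where
  "hausdorff1 = measure_of UNIV (sets borel) hausdorff1_outer"

section \<open>Curves of class \<open>C\<^sup>2\<close>\<close>

text \<open>Embedded one-dimensional \<open>C\<^sup>2\<close> submanifolds of the plane. Connectedness is not required, so
  that the boundary of a core may consist of several closed curves.\<close>

definition C2_curve :: "(real^2) set \<Rightarrow> bool" where
  "C2_curve \<Gamma> \<longleftrightarrow> (\<forall>p\<in>\<Gamma>. \<exists>U \<gamma> \<tau>. open U \<and> p \<in> U \<and>
     \<gamma> C1_differentiable_on {-1<..<1} \<and>
     (\<lambda>t. vector_derivative \<gamma> (at t)) C1_differentiable_on {-1<..<1} \<and>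
     (\<forall>t\<in>{-1<..<1}. vector_derivative \<gamma> (at t) \<noteq> 0) \<and>
     homeomorphism {-1<..<1} (\<Gamma> \<inter> U) \<gamma> \<tau>)"

section \<open>Test functions\<close>

definition partial_deriv :: "2 \<Rightarrow> (real^2 \<Rightarrow> real) \<Rightarrow> real^2 \<Rightarrow> real" where
  "partial_deriv i \<phi> x = frechet_derivative \<phi> (at x) (axis i 1)"

primrec C_k :: "nat \<Rightarrow> (real^2 \<Rightarrow> real) \<Rightarrow> bool" where
  "C_k 0 \<phi> \<longleftrightarrow> continuous_on UNIV \<phi>"
| "C_k (Suc k) \<phi> \<longleftrightarrow> (\<forall>x. \<phi> differentiable (at x)) \<and> (\<forall>i. C_k k (partial_deriv i \<phi>))"

definition test_fun :: "(real^2 \<Rightarrow> real) \<Rightarrow> bool" where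
  "test_fun \<phi> \<longleftrightarrow> (\<forall>k. C_k k \<phi>) \<and> compact (closure {x. \<phi> x \<noteq> 0})"

section \<open>Weak gradients and the homogeneous Sobolev space\<close>

definition locally_integrable ::
    "(real^2 \<Rightarrow> 'b::{banach, second_countable_topology}) \<Rightarrow> bool" where
  "locally_integrable u \<longleftrightarrow> (\<forall>K. compact K \<longrightarrow> set_integrable lebesgue K u)"

definition is_weak_gradient :: "(real^2 \<Rightarrow> complex) \<Rightarrow> (real^2 \<Rightarrow> complex^2) \<Rightarrow> bool" where
  "is_weak_gradient u G \<longleftrightarrow> locally_integrable u \<and> locally_integrable G \<and>
     (\<forall>\<phi> i. test_fun \<phi> \<longrightarrow>
        (\<integral>x. partial_deriv i \<phi> x *\<^sub>R u x \<partial>lebesgue) = - (\<integral>x. \<phi> x *\<^sub>R (G x $ i) \<partial>lebesgue))"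

text \<open>Weak gradients are unique almost everywhere; one representative is chosen.\<close>

definition weak_grad :: "(real^2 \<Rightarrow> complex) \<Rightarrow> real^2 \<Rightarrow> complex^2" where
  "weak_grad u = (SOME G. is_weak_gradient u G)"

definition Hdot1 :: "(real^2 \<Rightarrow> complex) set" where
  "Hdot1 = {u. u \<in> borel_measurable lebesgue \<and>
     (\<forall>K. compact K \<longrightarrow> set_integrable lebesgue K (\<lambda>x. (norm (u x))\<^sup>2)) \<and>
     (\<exists>G. is_weak_gradient u G) \<and>
     weak_grad u \<in> borel_measurable lebesgue \<and>
     integrable lebesgue (\<lambda>x. (norm (weak_grad u x))\<^sup>2)}"

section \<open>The conductivity problem and resonance\<close>

text \<open>The source \<open>F \<H>\<^sup>1\<lfloor>\<Gamma>\<close>, as a functional on test functions.\<close>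

definition curve_source :: "(real^2) set \<Rightarrow> (real^2 \<Rightarrow> real) \<Rightarrow> (real^2 \<Rightarrow> real) \<Rightarrow> real" where
  "curve_source \<Gamma> F \<phi> = (\<integral>x. F x * \<phi> x \<partial>(restrict_space hausdorff1 \<Gamma>))"

text \<open>Weak solutions of \<open>\<nabla>\<cdot>(a\<nabla>u) = f\<close>; the last conjunct is the condition \<open>\<nabla>u \<rightarrow> 0\<close> at infinity.
  The product of the gradients is bilinear, not Hermitian. Real test functions suffice
  by linearity.\<close>

definition weak_solution ::
    "(real^2 \<Rightarrow> complex) \<Rightarrow> ((real^2 \<Rightarrow> real) \<Rightarrow> real) \<Rightarrow> (real^2 \<Rightarrow> complex) \<Rightarrow> bool" where
  "weak_solution a f u \<longleftrightarrow> u \<in> Hdot1 \<and>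
     (\<forall>\<phi>. test_fun \<phi> \<longrightarrow>
        (\<integral>x. a x * (\<Sum>i\<in>UNIV. weak_grad u x $ i * of_real (partial_deriv i \<phi> x)) \<partial>lebesgue)
          = - of_real (f \<phi>)) \<and>
     (\<forall>\<epsilon>>0. \<exists>M. AE x in lebesgue. M < norm x \<longrightarrow> norm (weak_grad u x) < \<epsilon>)"

definition energy :: "real \<Rightarrow> (real^2 \<Rightarrow> complex) \<Rightarrow> real" where
  "energy \<eta> u = \<eta> / 2 * (\<integral>x. (norm (weak_grad u x))\<^sup>2 \<partial>lebesgue)"

text \<open>For \<open>A\<close> bounded and measurable, equal to 1 near infinity, and \<open>f = F \<H>\<^sup>1\<lfloor>\<partial>B\<^sub>q\<close> with \<open>F\<close> square
  integrable of mean zero, the Lax-Milgram theorem, applied with the coercive imaginary part \<open>\<eta>\<close> of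
  the coefficient, gives a solution for every \<open>\<eta> > 0\<close>, unique up to an additive constant. Its
  gradient is square integrable and harmonic near infinity, hence tends to 0. So the energies do not
  depend on the choice of the family \<open>u\<close> of solutions.\<close>

definition resonant :: "(real^2 \<Rightarrow> real) \<Rightarrow> ((real^2 \<Rightarrow> real) \<Rightarrow> real) \<Rightarrow> bool" where
  "resonant A f \<longleftrightarrow>
     (\<forall>u. (\<forall>\<eta>>0. weak_solution (\<lambda>x. of_real (A x) + \<i> * of_real \<eta>) f (u \<eta>)) \<longrightarrow>
        Limsup (at_right 0) (\<lambda>\<eta>. ereal (energy \<eta> (u \<eta>))) = \<infinity>)"

end

theory Submission
  imports Defs
begin

text \<open>
  Write \<open>z = x\<^sub>1 + \<i> x\<^sub>2\<close>, \<open>r = \<bar>z\<bar>\<close>, and let \<open>G\<close> be the gradient of a solution with loss parameter \<open>\<eta>\<close>.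
  If the core were absent, the coefficient would be \<open>-1\<close> in all of the disk of radius \<open>R\<close>, and then the
  plasmon \<open>\<phi>\<close>, equal to \<open>Re z^k\<close> for \<open>r < R\<close> and to \<open>(R/r)^(2k) Re z^k\<close> for \<open>r > R\<close>, would have a
  divergence-free flux \<open>A \<nabla>\<phi>\<close>. More precisely this flux would be the rotated gradient
  \<open>(-\<partial>\<^sub>2\<zeta>, \<partial>\<^sub>1\<zeta>)\<close> of the conjugate plasmon \<open>\<zeta>\<close>, which has \<open>Im z^k\<close> in place of \<open>Re z^k\<close>. The actual
  core lies in the unit disk, where \<open>\<bar>\<nabla>\<phi>\<bar> \<le> k\<close>, while \<open>\<bar>\<nabla>\<phi>\<bar>\<close> reaches the size \<open>k R^(k-1)\<close>. So the
  core, whatever its shape, spoils this identity only by \<open>O(k)\<close>.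

  Testing the equation with \<open>\<phi>\<close>, and using that \<open>G\<close> is curl-free, gives
  \<open>- f(\<phi>) = \<integral> G \<bullet> V\<close> with \<open>V = A \<nabla>\<phi> - (-\<partial>\<^sub>2\<zeta>, \<partial>\<^sub>1\<zeta>) + \<i> \<eta> \<nabla>\<phi>\<close>. For \<open>\<eta> = R^(-k)\<close> the last term has \<open>L\<^sup>2\<close> norm
  \<open>O(k)\<close> too, so that by the Cauchy-Schwarz inequality \<open>f(\<phi>)\<^sup>2 \<le> C k\<^sup>2 \<parallel>G\<parallel>\<^sup>2\<close>
  (\<open>trial_functions\<close>, \<open>weak_solution_lower_bound\<close>). For the source with density
  \<open>F = (\<Sum>j\<ge>1. j\<^sup>-\<^sup>2 Re (z/q)^j)\<close> on the circle of radius \<open>q\<close>, orthogonality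
  (\<open>integral_source_Re_power\<close>) gives \<open>f(\<phi>) = c R^(2k) / (k\<^sup>2 q^k)\<close>, with \<open>c > 0\<close> independent of \<open>k\<close>. Hence the energy at
  \<open>\<eta> = R^(-k)\<close> is at least a constant times \<open>(R\<^sup>3 / q\<^sup>2)^k / k\<^sup>6\<close>, which is unbounded because
  \<open>q < R^(3/2)\<close>. The same estimate holds for every family of solutions.

  Three points need work. The plasmon is only Lipschitz and has unbounded support, so it is replaced by
  \<open>g(r\<^sup>2) Re z^k\<close> with a smooth compactly supported \<open>g\<close>: the kink at \<open>r = R\<close> is smoothed in an
  exponentially thin layer, and the cutoff is placed at \<open>r \<ge> R\<^sup>2\<close>, where the plasmon is of size at most one
  (\<open>radial_profile\<close>); such a \<open>g\<close> is built from \<open>exp (-1/x)\<close>. That Hausdorff measure really is a measure on the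
  Borel sets rests on the Caratheodory criterion (\<open>metric_outer_measure_closed\<close>). Its moments on circles
  then follow from rotation invariance together with the finiteness and positivity of the length of a circle, and no
  parametrization of the circle is differentiated. Finally the coefficient is Lebesgue measurable
  because \<open>C\<^sup>2\<close> curves are null sets.
\<close>

section \<open>Hausdorff measure of dimension one is a Borel measure\<close>

lemma hausdorff1_pre_le:
  assumes "S \<subseteq> (\<Union>i. C i)" "\<And>i. bounded (C i)" "\<And>i. diameter (C i) \<le> \<delta>"
  shows "hausdorff1_pre \<delta> S \<le> (\<Sum>i. ennreal (diameter (C i)))"
  unfolding hausdorff1_pre_def by (rule INF_lower) (use assms in auto)

lemma hausdorff1_pre_geI:
  assumes "\<And>C. \<lbrakk>S \<subseteq> (\<Union>i. C i); \<And>i. bounded (C i); \<And>i. diameter (C i) \<le> \<delta>\<rbrakk>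
             \<Longrightarrow> m \<le> (\<Sum>i::nat. ennreal (diameter (C i)))"
  shows "m \<le> hausdorff1_pre \<delta> S"
  unfolding hausdorff1_pre_def by (rule INF_greatest) (use assms in auto)

lemma hausdorff1_pre_mono: "S \<subseteq> T \<Longrightarrow> hausdorff1_pre \<delta> S \<le> hausdorff1_pre \<delta> T"
  by (rule hausdorff1_pre_geI, rule hausdorff1_pre_le) auto

lemma hausdorff1_pre_antimono: "\<delta> \<le> \<epsilon> \<Longrightarrow> hausdorff1_pre \<epsilon> S \<le> hausdorff1_pre \<delta> S"
  by (rule hausdorff1_pre_geI, rule hausdorff1_pre_le) (auto intro: order_trans)

lemma hausdorff1_pre_le_outer: "\<delta> > 0 \<Longrightarrow> hausdorff1_pre \<delta> S \<le> hausdorff1_outer S"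
  unfolding hausdorff1_outer_def by (rule SUP_upper) auto

lemma hausdorff1_outer_leI: "(\<And>\<delta>. \<delta> > 0 \<Longrightarrow> hausdorff1_pre \<delta> S \<le> m) \<Longrightarrow> hausdorff1_outer S \<le> m"
  unfolding hausdorff1_outer_def by (rule SUP_least) auto

lemma hausdorff1_outer_mono: "S \<subseteq> T \<Longrightarrow> hausdorff1_outer S \<le> hausdorff1_outer T"
  by (rule hausdorff1_outer_leI) (blast intro: order_trans hausdorff1_pre_mono hausdorff1_pre_le_outer)

lemma hausdorff1_outer_empty: "hausdorff1_outer {} = 0"
proof -
  have "hausdorff1_pre \<delta> {} \<le> 0" if "\<delta> > 0" for \<delta>
    using hausdorff1_pre_le[of "{}" "\<lambda>_. {}" \<delta>] that by simp
  then have "hausdorff1_outer {} \<le> 0" by (rule hausdorff1_outer_leI)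
  then show ?thesis by simp
qed

text \<open>Near-optimal coverings of the pieces, with errors \<open>e / 2^(n+1)\<close>, are merged into one
  covering by means of the pairing bijection.\<close>

lemma hausdorff1_pre_UN_le:
  "hausdorff1_pre \<delta> (\<Union>n. A n) \<le> (\<Sum>n::nat. hausdorff1_pre \<delta> (A n))"
proof (rule ennreal_le_epsilon)
  fix e :: real assume e: "0 < e" "(\<Sum>n. hausdorff1_pre \<delta> (A n)) < top"
  then have *: "hausdorff1_pre \<delta> (A n) < hausdorff1_pre \<delta> (A n) + e * (1/2)^Suc n" for n
    by (auto simp add: less_top dest!: ennreal_suminf_lessD)
  have "\<exists>C :: nat \<Rightarrow> _. A n \<subseteq> (\<Union>i. C i) \<and> (\<forall>i. bounded (C i) \<and> diameter (C i) \<le> \<delta>) \<and>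
     (\<Sum>i. ennreal (diameter (C i))) \<le> hausdorff1_pre \<delta> (A n) + e * (1/2)^Suc n" for n
    using *[of n] unfolding hausdorff1_pre_def[of \<delta> "A n"] INF_less_iff by (auto intro: less_imp_le)
  then obtain B :: "nat \<Rightarrow> nat \<Rightarrow> 'a set" where
    B: "\<And>n. A n \<subseteq> (\<Union>i. B n i)" "\<And>n i. bounded (B n i)" "\<And>n i. diameter (B n i) \<le> \<delta>"
    and Ble: "\<And>n. (\<Sum>i. ennreal (diameter (B n i))) \<le> hausdorff1_pre \<delta> (A n) + e * (1/2)^Suc n"
    by metis
  define C where "C = case_prod B o prod_decode"
  have AC: "(\<Union>i. A i) \<subseteq> (\<Union>i. C i)"
    using B(1) by (auto simp add: C_def subset_eq) (metis prod.case prod_encode_inverse)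
  have "hausdorff1_pre \<delta> (\<Union>i. A i) \<le> (\<Sum>i. ennreal (diameter (C i)))"
    using AC B(2,3) by (intro hausdorff1_pre_le) (auto simp: C_def split_def)
  also have "\<dots> = (\<Sum>n. \<Sum>i. ennreal (diameter (B n i)))"
    using suminf_ennreal_2dimen[of "\<lambda>n. \<Sum>i. ennreal (diameter (B n i))" "\<lambda>p. ennreal (diameter (case_prod B p))"]
    unfolding C_def comp_def by auto
  also have "\<dots> \<le> (\<Sum>n. hausdorff1_pre \<delta> (A n) + e * (1/2) ^ Suc n)"
    by (intro suminf_le allI Ble) auto
  also have "... = (\<Sum>n. hausdorff1_pre \<delta> (A n)) + (\<Sum>n. ennreal e * ennreal ((1/2) ^ Suc n))"
    using \<open>0 < e\<close> by (subst suminf_add[symmetric])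
                     (auto simp del: ennreal_suminf_cmult simp add: ennreal_mult[symmetric])
  also have "\<dots> = (\<Sum>n. hausdorff1_pre \<delta> (A n)) + e"
    unfolding ennreal_suminf_cmult
    by (subst suminf_ennreal_eq[OF zero_le_power power_half_series]) auto
  finally show "hausdorff1_pre \<delta> (\<Union>i. A i) \<le> (\<Sum>n. hausdorff1_pre \<delta> (A n)) + e" .
qed

lemma hausdorff1_outer_UN_le:
  "hausdorff1_outer (\<Union>n. A n) \<le> (\<Sum>n::nat. hausdorff1_outer (A n))"
proof (rule hausdorff1_outer_leI)
  fix \<delta> :: real assume "\<delta> > 0"
  have "hausdorff1_pre \<delta> (\<Union>n. A n) \<le> (\<Sum>n. hausdorff1_pre \<delta> (A n))" by (rule hausdorff1_pre_UN_le)
  also have "\<dots> \<le> (\<Sum>n. hausdorff1_outer (A n))"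
    using \<open>\<delta> > 0\<close> by (intro suminf_le hausdorff1_pre_le_outer) auto
  finally show "hausdorff1_pre \<delta> (\<Union>n. A n) \<le> (\<Sum>n. hausdorff1_outer (A n))" .
qed

text \<open>A covering by sets of diameter below the distance of \<open>A\<close> and \<open>B\<close> contains no set that
  meets both, so it splits into a covering of \<open>A\<close> and one of \<open>B\<close>. This is what makes the
  outer measure metric.\<close>

lemma hausdorff1_outer_separated:
  assumes "\<epsilon> > 0" and sep: "\<And>x y. x \<in> A \<Longrightarrow> y \<in> B \<Longrightarrow> \<epsilon> \<le> dist x y"
  shows "hausdorff1_outer A + hausdorff1_outer B \<le> hausdorff1_outer (A \<union> B)"
proof -
  have "hausdorff1_pre \<delta> A + hausdorff1_pre \<delta>' B \<le> hausdorff1_outer (A \<union> B)"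
    if "\<delta> > 0" "\<delta>' > 0" for \<delta> \<delta>'
  proof -
    define \<rho> where "\<rho> = min (min \<delta> \<delta>') (\<epsilon>/2)"
    have "\<rho> > 0" "\<rho> \<le> \<delta>" "\<rho> \<le> \<delta>'" "\<rho> < \<epsilon>" using that assms by (auto simp: \<rho>_def)
    have "hausdorff1_pre \<rho> A + hausdorff1_pre \<rho> B \<le> hausdorff1_pre \<rho> (A \<union> B)"
    proof (rule hausdorff1_pre_geI)
      fix C :: "nat \<Rightarrow> 'a set"
      assume C: "A \<union> B \<subseteq> (\<Union>i. C i)" "\<And>i. bounded (C i)" "\<And>i. diameter (C i) \<le> \<rho>"
      define CA where "CA i = (if C i \<inter> A = {} then {} else C i)" for i
      define CB where "CB i = (if C i \<inter> B = {} then {} else C i)" for i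
      have disj: "C i \<inter> A = {} \<or> C i \<inter> B = {}" for i
      proof (rule ccontr)
        assume "\<not> ?thesis"
        then obtain x y where xy: "x \<in> C i" "x \<in> A" "y \<in> C i" "y \<in> B" by blast
        then have "dist x y \<le> \<rho>" using diameter_bounded_bound[OF C(2)] C(3) order_trans by blast
        with sep[of x y] xy \<open>\<rho> < \<epsilon>\<close> show False by simp
      qed
      have "hausdorff1_pre \<rho> A \<le> (\<Sum>i. ennreal (diameter (CA i)))"
        using C \<open>\<rho> > 0\<close> by (intro hausdorff1_pre_le) (fastforce simp: CA_def)+
      moreover have "hausdorff1_pre \<rho> B \<le> (\<Sum>i. ennreal (diameter (CB i)))"
        using C \<open>\<rho> > 0\<close> by (intro hausdorff1_pre_le) (fastforce simp: CB_def)+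
      ultimately have "hausdorff1_pre \<rho> A + hausdorff1_pre \<rho> B \<le>
          (\<Sum>i. ennreal (diameter (CA i))) + (\<Sum>i. ennreal (diameter (CB i)))"
        by (rule add_mono)
      also have "\<dots> = (\<Sum>i. ennreal (diameter (CA i)) + ennreal (diameter (CB i)))"
        by (rule suminf_add) auto
      also have "\<dots> \<le> (\<Sum>i. ennreal (diameter (C i)))"
        using disj by (intro suminf_le) (auto simp: CA_def CB_def)
      finally show "hausdorff1_pre \<rho> A + hausdorff1_pre \<rho> B \<le> (\<Sum>i. ennreal (diameter (C i)))" .
    qed
    moreover have "hausdorff1_pre \<delta> A + hausdorff1_pre \<delta>' B \<le> hausdorff1_pre \<rho> A + hausdorff1_pre \<rho> B"
      using \<open>\<rho> \<le> \<delta>\<close> \<open>\<rho> \<le> \<delta>'\<close> by (intro add_mono hausdorff1_pre_antimono)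
    ultimately show ?thesis using hausdorff1_pre_le_outer[OF \<open>\<rho> > 0\<close>, of "A \<union> B"] by order
  qed
  then have "(SUP \<delta>\<in>{0<..}. SUP \<delta>'\<in>{0<..}. hausdorff1_pre \<delta>' B + hausdorff1_pre \<delta> A) \<le> hausdorff1_outer (A \<union> B)"
    by (intro SUP_least) (auto simp: add.commute)
  then have "(SUP \<delta>\<in>{0<..}. hausdorff1_outer B + hausdorff1_pre \<delta> A) \<le> hausdorff1_outer (A \<union> B)"
    unfolding hausdorff1_outer_def[of B]
    by (subst (asm) ennreal_SUP_add_left) auto
  then have "(SUP \<delta>\<in>{0<..}. hausdorff1_pre \<delta> A + hausdorff1_outer B) \<le> hausdorff1_outer (A \<union> B)"
    by (simp add: add.commute)
  then show ?thesis
    unfolding hausdorff1_outer_def[of A]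
    by (subst (asm) ennreal_SUP_add_left) auto
qed

text \<open>The nontrivial half of the Caratheodory criterion. The part of \<open>E - C\<close> at distance at
  least \<open>1/(n+1)\<close> from \<open>C\<close> is separated from \<open>C\<close>, so additivity holds for it, and it
  remains to see that it exhausts the outer measure of \<open>E - C\<close>. The missing part is a union
  of shells. Two shells whose indices differ by at least two are separated, hence the even shells together
  weigh at most \<open>\<mu> E\<close>, and so do the odd ones. The series of all shells thus
  converges and its tails vanish.\<close>

lemma metric_outer_measure_closed:
  fixes \<mu> :: "'a::metric_space set \<Rightarrow> ennreal"
  assumes empty: "\<mu> {} = 0" and mono: "\<And>S T. S \<subseteq> T \<Longrightarrow> \<mu> S \<le> \<mu> T"
    and UN: "\<And>A. \<mu> (\<Union>n. A n) \<le> (\<Sum>n::nat. \<mu> (A n))"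
    and sep: "\<And>\<epsilon> A B. 0 < \<epsilon> \<Longrightarrow> (\<And>x y. x \<in> A \<Longrightarrow> y \<in> B \<Longrightarrow> \<epsilon> \<le> dist x y) \<Longrightarrow> \<mu> A + \<mu> B \<le> \<mu> (A \<union> B)"
    and "closed C"
  shows "\<mu> (E \<inter> C) + \<mu> (E - C) \<le> \<mu> E"
proof (cases "C = {} \<or> \<mu> E = \<infinity>")
  case True
  then show ?thesis by (auto simp: empty)
next
  case False
  then have "C \<noteq> {}" and fin: "\<mu> E < top" by (auto simp: less_top)
  define d where "d x = infdist x C" for x
  have d1: "d x \<le> dist x y" if "y \<in> C" for x y unfolding d_def by (rule infdist_le[OF that])
  have d2: "\<bar>d x - d y\<bar> \<le> dist x y" for x y
    using infdist_triangle[of x C y] infdist_triangle[of y C x] by (auto simp: d_def dist_commute)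
  define En where "En n = {x \<in> E. 1 / real (Suc n) \<le> d x}" for n
  define Sh where "Sh n = {x \<in> E. 1 / real (n + 2) \<le> d x \<and> d x < 1 / real (Suc n)}" for n
  \<comment> \<open>\<open>b\<close> selects the even shells (\<open>b = 0\<close>) or the odd shells (\<open>b = 1\<close>).\<close>
  have evenodd: "(\<Sum>i. \<mu> (Sh (2 * i + b))) \<le> \<mu> E" for b
  proof (rule suminf_le_const[OF summableI])
    fix N
    have "(\<Sum>i<N. \<mu> (Sh (2 * i + b))) \<le> \<mu> (\<Union>i<N. Sh (2 * i + b))"
    proof (induction N)
      case 0
      then show ?case by (simp add: empty)
    next
      case (Suc N)
      have 1: "\<mu> (\<Union>i<N. Sh (2 * i + b)) + \<mu> (Sh (2*N+b)) \<le> \<mu> ((\<Union>i<N. Sh (2 * i + b)) \<union> Sh (2*N+b))"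
      proof (rule sep)
        show "0 < (if N > 0 then 1 / real (2*N+b) - 1 / real (2*N+b+1) else 1)"
          by (simp add: divide_strict_left_mono)
        fix x y assume "x \<in> (\<Union>i<N. Sh (2 * i + b))" "y \<in> Sh (2*N+b)"
        then obtain i where i: "i < N" "x \<in> Sh (2*i+b)" by auto
        then have "1 / real (2*N+b) \<le> 1 / real (2*i+b+2)" by (intro divide_left_mono) auto
        also have "\<dots> \<le> d x" using i by (simp add: Sh_def)
        finally have "1 / real (2*N+b) \<le> d x" .
        moreover have "d y < 1 / real (2*N+b+1)" using \<open>y \<in> Sh (2*N+b)\<close> by (simp add: Sh_def add.commute)
        ultimately show "(if N > 0 then 1 / real (2*N+b) - 1 / real (2*N+b+1) else 1) \<le> dist x y"
          using d2[of x y] i by auto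
      qed
      have "(\<Sum>i<Suc N. \<mu> (Sh (2 * i + b))) \<le> \<mu> (\<Union>i<N. Sh (2 * i + b)) + \<mu> (Sh (2*N+b))"
        using Suc by (simp add: add_right_mono)
      also note 1
      also have "((\<Union>i<N. Sh (2 * i + b)) \<union> Sh (2*N+b)) = (\<Union>i<Suc N. Sh (2 * i + b))"
        by (auto simp: less_Suc_eq)
      finally show ?case .
    qed
    also have "\<dots> \<le> \<mu> E" by (rule mono) (auto simp: Sh_def)
    finally show "(\<Sum>i<N. \<mu> (Sh (2 * i + b))) \<le> \<mu> E" .
  qed
  have "(\<Sum>i. \<mu> (Sh i)) \<le> \<mu> E + \<mu> E"
  proof (rule suminf_le_const[OF summableI])
    fix N
    have "(\<Sum>i<N. \<mu> (Sh i)) \<le> (\<Sum>i<2*N. \<mu> (Sh i))" by (rule sum_mono2) auto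
    also have "\<dots> = (\<Sum>i<N. \<mu> (Sh (2*i+0))) + (\<Sum>i<N. \<mu> (Sh (2*i+1)))"
      by (induction N) (auto simp: algebra_simps)
    also have "\<dots> \<le> (\<Sum>i. \<mu> (Sh (2*i+0))) + (\<Sum>i. \<mu> (Sh (2*i+1)))"
      by (intro add_mono sum_le_suminf summableI) auto
    also have "\<dots> \<le> \<mu> E + \<mu> E" by (intro add_mono evenodd)
    finally show "(\<Sum>i<N. \<mu> (Sh i)) \<le> \<mu> E + \<mu> E" .
  qed
  also have "\<dots> < top" using fin by simp
  finally have sumfin: "(\<Sum>i. \<mu> (Sh i)) < top" .
  show ?thesis
  proof (rule ennreal_le_epsilon)
    fix e :: real assume "0 < e"
    have "\<exists>n. (\<Sum>i. \<mu> (Sh (i + n))) \<le> e"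
    proof (cases "(\<Sum>i. \<mu> (Sh i)) = 0")
      case True
      then show ?thesis by (intro exI[of _ 0]) simp
    next
      case False
      have "(\<Sum>i. \<mu> (Sh i)) - e < (\<Sum>i. \<mu> (Sh i))"
        using False sumfin \<open>0 < e\<close> by (intro ennreal_between) (auto simp: zero_less_iff_neq_zero)
      also have "\<dots> = (SUP n. \<Sum>i<n. \<mu> (Sh i))" by (rule suminf_eq_SUP)
      finally obtain n where n: "(\<Sum>i. \<mu> (Sh i)) - e < (\<Sum>i<n. \<mu> (Sh i))"
        unfolding less_SUP_iff by auto
      have "(\<Sum>i. \<mu> (Sh (i + n))) + (\<Sum>i<n. \<mu> (Sh i)) = (\<Sum>i. \<mu> (Sh i))"
        by (rule suminf_offset[symmetric, OF summableI])
      also have "\<dots> \<le> e + (\<Sum>i<n. \<mu> (Sh i))"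
        using n by (metis add.commute ennreal_minus_le_iff less_imp_le)
      finally have "(\<Sum>i<n. \<mu> (Sh i)) + (\<Sum>i. \<mu> (Sh (i + n))) \<le> (\<Sum>i<n. \<mu> (Sh i)) + e"
        by (simp add: add.commute)
      moreover have "(\<Sum>i<n. \<mu> (Sh i)) < top"
        using sum_le_suminf[OF summableI, of "{..<n}" "\<lambda>i. \<mu> (Sh i)"]
        by (intro le_less_trans[OF _ sumfin]) auto
      ultimately have "(\<Sum>i. \<mu> (Sh (i + n))) \<le> e"
        by (metis ennreal_add_left_cancel_le infinity_ennreal_def less_irrefl)
      then show ?thesis ..
    qed
    then obtain n where n: "(\<Sum>i. \<mu> (Sh (i + n))) \<le> e" ..
    define T where "T i = (if i = 0 then En n else Sh (i - 1 + n))" for i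
    have "E - C \<subseteq> (\<Union>i. T i)"
    proof
      fix x assume x: "x \<in> E - C"
      have "d x > 0"
        using x \<open>closed C\<close> \<open>C \<noteq> {}\<close> by (simp add: d_def infdist_pos_not_in_closed)
      then obtain m0 where "1 / real (Suc m0) < d x"
        using nat_approx_posE by (metis of_nat_Suc)
      then have "\<exists>m. 1 / real (Suc m) \<le> d x" by (intro exI) (rule less_imp_le)
      define m where "m = (LEAST m. 1 / real (Suc m) \<le> d x)"
      have m: "1 / real (Suc m) \<le> d x" unfolding m_def by (rule LeastI_ex) fact
      show "x \<in> (\<Union>i. T i)"
      proof (cases "m \<le> n")
        case True
        then have "1 / real (Suc n) \<le> 1 / real (Suc m)" by (intro divide_left_mono) auto
        then have "x \<in> T 0" using m x by (auto simp: T_def En_def)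
        then show ?thesis by blast
      next
        case False
        then have "\<not> 1 / real (Suc (m - 1)) \<le> d x"
          using not_less_Least[of "m - 1" "\<lambda>m. 1 / real (Suc m) \<le> d x"] unfolding m_def[symmetric] by auto
        then have "x \<in> Sh (m - 1)" using m x False by (auto simp: Sh_def)
        moreover have "T (m - n) = Sh (m - 1)" using False by (auto simp: T_def)
        ultimately show ?thesis by blast
      qed
    qed
    then have "\<mu> (E - C) \<le> (\<Sum>i. \<mu> (T i))" using mono UN order_trans by blast
    also have "\<dots> = (\<Sum>i. \<mu> (T (Suc i))) + \<mu> (T 0)"
      using suminf_offset[OF summableI, of "\<lambda>i. \<mu> (T i)" 1] by simp
    also have "\<dots> \<le> e + \<mu> (En n)" using n by (auto simp: T_def intro: add_right_mono)
    finally have "\<mu> (E \<inter> C) + \<mu> (E - C) \<le> \<mu> (E \<inter> C) + (e + \<mu> (En n))" by (rule add_left_mono)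
    also have "\<dots> = (\<mu> (E \<inter> C) + \<mu> (En n)) + e" by (simp add: ac_simps)
    also have "\<mu> (E \<inter> C) + \<mu> (En n) \<le> \<mu> (E \<inter> C \<union> En n)"
      by (rule sep[of "1 / real (Suc n)"]) (use d1 in \<open>auto simp: En_def dist_commute intro: order_trans\<close>)
    also have "\<mu> (E \<inter> C \<union> En n) \<le> \<mu> E" by (rule mono) (auto simp: En_def)
    finally show "\<mu> (E \<inter> C) + \<mu> (E - C) \<le> \<mu> E + e" by (auto intro: add_right_mono)
  qed
qed

lemma sets_hausdorff1 [simp, measurable_cong]: "sets (hausdorff1 :: 'a::metric_space measure) = sets borel"
  unfolding hausdorff1_def using sets.sets_measure_of_eq[of "borel :: 'a measure"] by simp

lemma space_hausdorff1 [simp]: "space hausdorff1 = UNIV"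
  using sets_eq_imp_space_eq[OF sets_hausdorff1] by simp

lemma emeasure_hausdorff1:
  fixes S :: "'a::metric_space set"
  assumes "S \<in> sets borel"
  shows "emeasure hausdorff1 S = hausdorff1_outer S"
proof -
  let ?L = "lambda_system UNIV (Pow UNIV) (hausdorff1_outer :: 'a set \<Rightarrow> ennreal)"
  interpret P: sigma_algebra UNIV "Pow (UNIV :: 'a set)" by (rule sigma_algebra_Pow)
  have oms: "outer_measure_space (Pow UNIV) (hausdorff1_outer :: 'a set \<Rightarrow> ennreal)"
    unfolding outer_measure_space_def positive_def increasing_def countably_subadditive_def
    by (auto simp: hausdorff1_outer_empty hausdorff1_outer_mono hausdorff1_outer_UN_le)
  have ms: "measure_space UNIV ?L hausdorff1_outer" by (rule P.caratheodory_lemma[OF oms])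
  then interpret L: sigma_algebra UNIV ?L by (simp add: measure_space_def)
  have "closed C \<Longrightarrow> C \<in> ?L" for C :: "'a set"
  proof -
    assume "closed C"
    have "hausdorff1_outer (x \<inter> C) + hausdorff1_outer (x - C) = hausdorff1_outer x" for x
    proof (rule antisym)
      show "hausdorff1_outer (x \<inter> C) + hausdorff1_outer (x - C) \<le> hausdorff1_outer x"
        by (rule metric_outer_measure_closed[OF hausdorff1_outer_empty hausdorff1_outer_mono
              hausdorff1_outer_UN_le hausdorff1_outer_separated \<open>closed C\<close>])
      have "subadditive (Pow UNIV) (hausdorff1_outer :: 'a set \<Rightarrow> ennreal)"
        using oms by (intro P.countably_subadditive_subadditive) (auto simp: outer_measure_space_def)
      from subadditiveD[OF this, of "x \<inter> C" "x - C"]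
      show "hausdorff1_outer x \<le> hausdorff1_outer (x \<inter> C) + hausdorff1_outer (x - C)"
        by (auto simp: Int_Diff_Un)
    qed
    then show "C \<in> ?L" unfolding P.lambda_system_eq by blast
  qed
  then have "sets borel \<subseteq> ?L"
    unfolding borel_eq_closed using L.sigma_sets_subset[of "Collect closed"] by (subst sets_measure_of) blast+
  then have "measure_space UNIV (sets borel) (hausdorff1_outer :: 'a set \<Rightarrow> ennreal)"
    using measure_down[OF ms] sets.sigma_algebra_axioms[of borel] by simp
  then show ?thesis
    unfolding hausdorff1_def using assms
    by (intro emeasure_measure_of_sigma) (auto simp: measure_space_def)
qed

section \<open>Lipschitz images and the length of circles\<close>

lemma diameter_le_bound:
  fixes S :: "'a::metric_space set"
  assumes "\<And>x y. x \<in> S \<Longrightarrow> y \<in> S \<Longrightarrow> dist x y \<le> d" "0 \<le> d"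
  shows "diameter S \<le> d"
  using assms by (auto simp: diameter_def intro!: cSUP_least)

lemma bounded_image_dist:
  assumes "\<And>x y. x \<in> S \<Longrightarrow> y \<in> S \<Longrightarrow> dist (f x) (f y) \<le> d"
  shows "bounded (f ` S)"
  unfolding bounded_def
proof (cases "S = {}")
  case False
  then obtain a where "a \<in> S" by blast
  then show "\<exists>x e. \<forall>y\<in>f ` S. dist x y \<le> e"
    using assms by (intro exI[of _ "f a"] exI[of _ d]) auto
qed auto

text \<open>With \<open>L = 1\<close> this yields invariance under isometries and the comparison of a circle with
  its projection to an axis; with \<open>L = q\<close> it bounds the length of a circle.\<close>

lemma hausdorff1_outer_lipschitz_image:
  fixes f :: "'a::metric_space \<Rightarrow> 'b::metric_space"
  assumes "0 < L" and lip: "\<And>x y. x \<in> S \<Longrightarrow> y \<in> S \<Longrightarrow> dist (f x) (f y) \<le> L * dist x y"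
  shows "hausdorff1_outer (f ` S) \<le> ennreal L * hausdorff1_outer S"
proof (rule hausdorff1_outer_leI)
  fix \<delta> :: real assume "\<delta> > 0"
  have "ennreal (1 / L) * hausdorff1_pre \<delta> (f ` S) \<le> hausdorff1_pre (\<delta> / L) S"
  proof (rule hausdorff1_pre_geI)
    fix C :: "nat \<Rightarrow> 'a set"
    assume C: "S \<subseteq> (\<Union>i. C i)" "\<And>i. bounded (C i)" "\<And>i. diameter (C i) \<le> \<delta> / L"
    have d: "dist (f x) (f y) \<le> L * diameter (C i)" if "x \<in> C i \<inter> S" "y \<in> C i \<inter> S" for x y i
      using lip[of x y] diameter_bounded_bound[OF C(2)[of i], of x y] that \<open>0 < L\<close>
      by (auto intro: order_trans mult_left_mono)
    have D: "diameter (f ` (C i \<inter> S)) \<le> L * diameter (C i)" for i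
      using d diameter_ge_0[OF C(2)[of i]] \<open>0 < L\<close> by (intro diameter_le_bound) auto
    have "hausdorff1_pre \<delta> (f ` S) \<le> (\<Sum>i. ennreal (diameter (f ` (C i \<inter> S))))"
    proof (rule hausdorff1_pre_le)
      have "S = (\<Union>i. C i \<inter> S)" using C(1) by auto
      then show "f ` S \<subseteq> (\<Union>i. f ` (C i \<inter> S))" by (metis image_UN order_refl)
      show "bounded (f ` (C i \<inter> S))" for i by (rule bounded_image_dist[OF d])
      have "L * diameter (C i) \<le> \<delta>" for i using C(3)[of i] \<open>0 < L\<close> by (simp add: field_simps)
      with D show "diameter (f ` (C i \<inter> S)) \<le> \<delta>" for i by (meson order_trans)
    qed
    also have "\<dots> \<le> (\<Sum>i. ennreal L * ennreal (diameter (C i)))"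
      using D \<open>0 < L\<close> by (intro suminf_le) (auto simp: ennreal_mult'[symmetric] intro: ennreal_leI)
    also have "\<dots> = ennreal L * (\<Sum>i. ennreal (diameter (C i)))" by (rule ennreal_suminf_cmult)
    finally have "ennreal (1 / L) * hausdorff1_pre \<delta> (f ` S) \<le> ennreal (1/L) * (ennreal L * (\<Sum>i. ennreal (diameter (C i))))"
      by (rule mult_left_mono) simp
    also have "\<dots> = (\<Sum>i. ennreal (diameter (C i)))"
      using \<open>0 < L\<close> by (simp add: mult.assoc[symmetric] ennreal_mult'[symmetric])
    finally show "ennreal (1 / L) * hausdorff1_pre \<delta> (f ` S) \<le> (\<Sum>i. ennreal (diameter (C i)))" .
  qed
  also have "\<dots> \<le> hausdorff1_outer S"
    using \<open>\<delta> > 0\<close> \<open>0 < L\<close> by (intro hausdorff1_pre_le_outer) auto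
  finally have "ennreal L * (ennreal (1 / L) * hausdorff1_pre \<delta> (f ` S)) \<le> ennreal L * hausdorff1_outer S"
    by (rule mult_left_mono) simp
  then show "hausdorff1_pre \<delta> (f ` S) \<le> ennreal L * hausdorff1_outer S"
    using \<open>0 < L\<close> by (simp add: mult.assoc[symmetric] ennreal_mult'[symmetric])
qed

lemma hausdorff1_outer_interval_le:
  fixes a b :: real
  assumes "a \<le> b"
  shows "hausdorff1_outer {a..b} \<le> ennreal (b - a)"
proof (rule hausdorff1_outer_leI)
  fix \<delta> :: real assume "\<delta> > 0"
  obtain N where N: "(b - a) / \<delta> < real N" using reals_Archimedean2 by blast
  then have "N > 0" using assms \<open>\<delta> > 0\<close> by (cases N) (auto simp: field_simps)
  define h where "h = (b - a) / real N"
  have h: "0 \<le> h" "h \<le> \<delta>" "real N * h = b - a"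
    using N \<open>N > 0\<close> assms \<open>\<delta> > 0\<close> by (auto simp: h_def field_simps)
  define C where "C i = (if i < N then {a + real i * h .. a + (real i + 1) * h} else {})" for i
  have dC: "diameter (C i) \<le> (if i < N then h else 0)" for i
    using h by (auto simp: C_def dist_real_def algebra_simps abs_le_iff intro!: diameter_le_bound)
  have "hausdorff1_pre \<delta> {a..b} \<le> (\<Sum>i. ennreal (diameter (C i)))"
  proof (rule hausdorff1_pre_le)
    show "{a..b} \<subseteq> (\<Union>i. C i)"
    proof
      fix x assume x: "x \<in> {a..b}"
      show "x \<in> (\<Union>i. C i)"
      proof (cases "x = b \<or> h = 0")
        case True
        then have "x \<in> C (N - 1)"
          using x h \<open>N > 0\<close> by (auto simp: C_def of_nat_diff algebra_simps)
        then show ?thesis by blast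
      next
        case False
        then have "h > 0" "x < b" using h x by auto
        define i where "i = nat \<lfloor>(x - a) / h\<rfloor>"
        have i: "real i \<le> (x - a) / h" "(x - a) / h < real i + 1"
          using x \<open>h > 0\<close> by (auto simp: i_def)
        have "(x - a) / h < real N" using h \<open>h > 0\<close> \<open>x < b\<close> by (simp add: field_simps)
        then have "i < N" using i by linarith
        moreover have "a + real i * h \<le> x" "x \<le> a + (real i + 1) * h"
          using i \<open>h > 0\<close> by (auto simp: field_simps)
        ultimately have "x \<in> C i" by (simp add: C_def)
        then show ?thesis by blast
      qed
    qed
    show "bounded (C i)" for i by (simp add: C_def)
    show "diameter (C i) \<le> \<delta>" for i using dC[of i] h \<open>\<delta> > 0\<close> by (auto split: if_splits)
  qed
  also have "\<dots> \<le> (\<Sum>i. ennreal (if i < N then h else 0))"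
    using dC by (intro suminf_le ennreal_leI) auto
  also have "\<dots> = (\<Sum>i<N. ennreal (if i < N then h else 0))"
    by (rule suminf_finite) auto
  also have "\<dots> = ennreal (b - a)"
    using h by (simp add: ennreal_of_nat_eq_real_of_nat ennreal_mult'[symmetric])
  finally show "hausdorff1_pre \<delta> {a..b} \<le> ennreal (b - a)" .
qed

text \<open>Compares with Lebesgue measure: a set of diameter \<open>d\<close> lies in an interval of
  length \<open>2 d\<close>. The factor 2 is not sharp, but only positivity is of interest.\<close>

lemma hausdorff1_outer_interval_ge:
  fixes a b :: real
  assumes "a \<le> b"
  shows "ennreal (b - a) \<le> 2 * hausdorff1_outer {a..b}"
proof -
  have "ennreal ((b - a) / 2) \<le> hausdorff1_pre 1 {a..b}"
  proof (rule hausdorff1_pre_geI)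
    fix C :: "nat \<Rightarrow> real set"
    assume C: "{a..b} \<subseteq> (\<Union>i. C i)" "\<And>i. bounded (C i)"
    define c where "c i = (SOME x. x \<in> C i)" for i
    define I where "I i = {c i - diameter (C i) .. c i + diameter (C i)}" for i
    have "C i \<subseteq> I i" for i
    proof
      fix x assume "x \<in> C i"
      then have "c i \<in> C i" unfolding c_def by (rule someI)
      with \<open>x \<in> C i\<close> have "dist x (c i) \<le> diameter (C i)" using diameter_bounded_bound[OF C(2)] by blast
      then show "x \<in> I i" by (auto simp: I_def dist_real_def)
    qed
    then have "(\<Union>i. C i) \<subseteq> (\<Union>i. I i)" by (intro UN_mono) auto
    with C(1) have sub: "{a..b} \<subseteq> (\<Union>i. I i)" by (rule order_trans)
    have "ennreal (b - a) = emeasure lborel {a..b}" using assms by simp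
    also have "\<dots> \<le> emeasure lborel (\<Union>i. I i)"
      using sub by (rule emeasure_mono) (auto simp: I_def)
    also have "\<dots> \<le> (\<Sum>i. emeasure lborel (I i))"
      by (rule emeasure_subadditive_countably) (auto simp: I_def)
    also have "\<dots> = (\<Sum>i. 2 * ennreal (diameter (C i)))"
    proof (rule suminf_cong)
      fix i
      show "emeasure lborel (I i) = 2 * ennreal (diameter (C i))"
        using diameter_ge_0[OF C(2)[of i]] ennreal_mult'[of 2 "diameter (C i)"] by (simp add: I_def)
    qed
    also have "\<dots> = 2 * (\<Sum>i. ennreal (diameter (C i)))" by simp
    finally have le: "ennreal (b - a) \<le> 2 * (\<Sum>i. ennreal (diameter (C i)))" .
    show "ennreal ((b - a) / 2) \<le> (\<Sum>i. ennreal (diameter (C i)))"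
    proof (cases "\<Sum>i. ennreal (diameter (C i))" rule: ennreal_cases)
      case (real r)
      with le have "ennreal (b - a) \<le> ennreal (2 * r)" by (simp add: ennreal_mult)
      with real show ?thesis by (simp add: ennreal_leI)
    qed simp
  qed
  also have "\<dots> \<le> hausdorff1_outer {a..b}" by (rule hausdorff1_pre_le_outer) simp
  finally have "ennreal 2 * ennreal ((b - a) / 2) \<le> ennreal 2 * hausdorff1_outer {a..b}"
    by (rule mult_left_mono) simp
  moreover have "ennreal (b - a) = 2 * ennreal ((b - a) / 2)"
    using ennreal_mult'[of 2 "(b - a) / 2"] by (simp only: times_divide_eq_right nonzero_mult_div_cancel_left[OF zero_neq_numeral[symmetric]] zero_le_numeral ennreal_numeral)
  ultimately show ?thesis by simp
qed

text \<open>The identification of the plane with the complex numbers makes rotations and the harmonic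
  polynomials \<open>Re z^k\<close> available as products and powers.\<close>

definition to_complex :: "real^2 \<Rightarrow> complex" where
  "to_complex x = Complex (x $ 1) (x $ 2)"

definition of_complex :: "complex \<Rightarrow> real^2" where
  "of_complex z = vector [Re z, Im z]"

lemma to_of_complex [simp]: "to_complex (of_complex z) = z" "of_complex (to_complex x) = x"
  by (auto simp: to_complex_def of_complex_def vec_eq_iff forall_2)

lemma to_complex_diff: "to_complex (x - y) = to_complex x - to_complex y"
  by (simp add: to_complex_def complex_eq_iff)

lemma of_complex_diff: "of_complex (x - y) = of_complex x - of_complex y"
  by (simp add: of_complex_def vec_eq_iff forall_2)

lemma cmod_to_complex [simp]: "cmod (to_complex x) = norm x"
  by (simp add: to_complex_def cmod_def norm_vec_def L2_set_def sum_2)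

lemma norm_of_complex [simp]: "norm (of_complex z) = cmod z"
  by (metis cmod_to_complex to_of_complex(1))

lemma continuous_on_to_complex [continuous_intros]: "continuous_on S to_complex"
  unfolding to_complex_def Complex_eq by (intro continuous_intros)

lemma measurable_to_complex [measurable]: "to_complex \<in> borel_measurable borel"
  by (intro borel_measurable_continuous_onI continuous_intros)

definition rotate2 :: "real \<Rightarrow> real^2 \<Rightarrow> real^2" where
  "rotate2 \<alpha> x = of_complex (cis \<alpha> * to_complex x)"

lemma to_complex_rotate2 [simp]: "to_complex (rotate2 \<alpha> x) = cis \<alpha> * to_complex x"
  by (simp add: rotate2_def)

lemma dist_rotate2: "dist (rotate2 \<alpha> x) (rotate2 \<alpha> y) = dist x y"
proof -
  have "dist (rotate2 \<alpha> x) (rotate2 \<alpha> y) = cmod (to_complex (rotate2 \<alpha> x - rotate2 \<alpha> y))"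
    by (simp only: cmod_to_complex dist_norm)
  also have "\<dots> = cmod (cis \<alpha> * to_complex (x - y))"
    by (simp only: to_complex_diff to_complex_rotate2 right_diff_distrib)
  also have "\<dots> = dist x y" by (simp add: norm_mult dist_norm)
  finally show ?thesis .
qed

lemma rotate2_minus [simp]: "rotate2 (-\<alpha>) (rotate2 \<alpha> x) = x" "rotate2 \<alpha> (rotate2 (-\<alpha>) x) = x"
  unfolding rotate2_def by (simp_all add: mult.assoc[symmetric] cis_mult)

lemma norm_rotate2 [simp]: "norm (rotate2 \<alpha> x) = norm x"
  unfolding rotate2_def by (simp add: norm_mult)

lemma measurable_rotate2 [measurable]: "rotate2 \<alpha> \<in> borel_measurable borel"
proof (rule borel_measurable_continuous_onI)
  show "continuous_on UNIV (rotate2 \<alpha>)"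
    by (intro lipschitz_on_continuous_on[of 1] lipschitz_onI) (auto simp: dist_rotate2)
qed

lemma hausdorff1_distr_rotate2: "distr hausdorff1 borel (rotate2 \<alpha>) = hausdorff1"
proof (rule measure_eqI)
  have le: "hausdorff1_outer (rotate2 \<beta> ` S) \<le> hausdorff1_outer S" for \<beta> S
    using hausdorff1_outer_lipschitz_image[of 1 S "rotate2 \<beta>"] by (simp add: dist_rotate2)
  fix S assume "S \<in> sets (distr hausdorff1 borel (rotate2 \<alpha>))"
  then have [measurable]: "S \<in> sets borel" by simp
  have vim: "rotate2 \<alpha> -` S = rotate2 (-\<alpha>) ` S"
    by (auto simp: image_iff) (metis rotate2_minus(1))
  have "S = rotate2 \<alpha> ` (rotate2 (-\<alpha>) ` S)" by (simp add: image_image)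
  then have "hausdorff1_outer S \<le> hausdorff1_outer (rotate2 (-\<alpha>) ` S)" by (metis le)
  then have "hausdorff1_outer (rotate2 \<alpha> -` S) = hausdorff1_outer S"
    unfolding vim using le by (rule antisym[rotated])
  moreover have "rotate2 \<alpha> -` S \<in> sets borel"
    using measurable_sets[OF measurable_rotate2[of \<alpha>] \<open>S \<in> sets borel\<close>] by simp
  ultimately show "emeasure (distr hausdorff1 borel (rotate2 \<alpha>)) S = emeasure hausdorff1 S"
    by (simp add: emeasure_distr emeasure_hausdorff1)
qed (simp only: sets_distr sets_hausdorff1)

lemma hausdorff1_sphere_finite:
  assumes "q > 0"
  shows "emeasure hausdorff1 (sphere (0::real^2) q) < \<infinity>"
proof -
  define f where "f t = of_complex (of_real q * cis t)" for t
  have "dist (f s) (f t) \<le> q * dist s t" for s t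
  proof -
    have "dist (f s) (f t) = cmod (of_real q * (cis s - cis t))"
      unfolding f_def dist_norm of_complex_diff[symmetric] norm_of_complex right_diff_distrib ..
    also have "\<dots> = q * cmod (cis s - cis t)" using assms by (simp add: norm_mult)
    also have "cmod (cis s - cis t) \<le> \<bar>s - t\<bar>"
    proof -
      have "cis s - cis t = cis t * (cis (s - t) - 1)"
        by (simp add: right_diff_distrib cis_mult)
      then have "cmod (cis s - cis t) = cmod (exp (\<i> * of_real (s - t)) - 1)"
        by (simp only: norm_mult norm_cis cis_conv_exp norm_exp_i_times mult_1)
      also have "\<dots> \<le> \<bar>s - t\<bar>"
        unfolding dist_exp_i_1 using abs_sin_x_le_abs_x[of "(s - t) / 2"] by simp
      finally show ?thesis .
    qed
    finally show ?thesis using assms by (simp add: dist_real_def)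
  qed
  then have "hausdorff1_outer (f ` {0..2*pi}) \<le> ennreal q * hausdorff1_outer {0..2*pi}"
    using assms by (intro hausdorff1_outer_lipschitz_image) auto
  also have "\<dots> \<le> ennreal q * ennreal (2*pi - 0)"
    by (intro mult_left_mono hausdorff1_outer_interval_le) auto
  also have "\<dots> < \<infinity>" by (simp add: ennreal_mult_less_top)
  finally have 1: "hausdorff1_outer (f ` {0..2*pi}) < \<infinity>" .
  have "sphere 0 q \<subseteq> f ` {0..2*pi}"
  proof
    fix x :: "real^2" assume "x \<in> sphere 0 q"
    then have n: "cmod (to_complex x) = q" by simp
    have "to_complex x = of_real q * cis (Arg2pi (to_complex x))"
      using Arg2pi_eq[of "to_complex x"] n by (simp add: cis_conv_exp)
    then have "x = f (Arg2pi (to_complex x))" unfolding f_def by (metis to_of_complex(2))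
    moreover have "Arg2pi (to_complex x) \<in> {0..2*pi}"
      using Arg2pi_ge_0 Arg2pi_lt_2pi less_imp_le by auto
    ultimately show "x \<in> f ` {0..2*pi}" by blast
  qed
  then show ?thesis using 1 hausdorff1_outer_mono by (subst emeasure_hausdorff1) (auto intro: le_less_trans)
qed

text \<open>The projection to the first axis is 1-Lipschitz and maps the circle onto \<open>{-q..q}\<close>.\<close>

lemma hausdorff1_sphere_pos:
  assumes "q > 0"
  shows "0 < emeasure hausdorff1 (sphere (0::real^2) q)"
proof -
  have "{-q..q} \<subseteq> (\<lambda>x. x $ 1) ` sphere (0::real^2) q"
  proof
    fix t assume t: "t \<in> {-q..q}"
    then have "t\<^sup>2 \<le> q\<^sup>2" by (intro abs_le_square_iff[THEN iffD1]) auto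
    define x where "x = of_complex (Complex t (sqrt (q\<^sup>2 - t\<^sup>2)))"
    have "norm x = q" using \<open>t\<^sup>2 \<le> q\<^sup>2\<close> assms by (simp add: x_def cmod_def)
    moreover have "x $ 1 = t" by (simp add: x_def of_complex_def)
    ultimately show "t \<in> (\<lambda>x. x $ 1) ` sphere (0::real^2) q" by force
  qed
  then have "hausdorff1_outer {-q..q} \<le> hausdorff1_outer ((\<lambda>x. x $ 1) ` sphere (0::real^2) q)"
    by (rule hausdorff1_outer_mono)
  also have "\<dots> \<le> ennreal 1 * hausdorff1_outer (sphere (0::real^2) q)"
    by (intro hausdorff1_outer_lipschitz_image) (auto simp: dist_vec_nth_le)
  finally have "hausdorff1_outer {-q..q} \<le> hausdorff1_outer (sphere (0::real^2) q)" by simp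
  moreover have "0 < ennreal (q - (-q))" using assms by simp
  moreover have "ennreal (q - (-q)) \<le> 2 * hausdorff1_outer {-q..q}"
    using assms by (intro hausdorff1_outer_interval_ge) auto
  ultimately have "hausdorff1_outer (sphere (0::real^2) q) \<noteq> 0" by auto
  then show ?thesis by (simp add: emeasure_hausdorff1 zero_less_iff_neq_zero)
qed

section \<open>Moments on circles and the source\<close>

abbreviation arc_measure :: "real \<Rightarrow> (real^2) measure" where
  "arc_measure q \<equiv> restrict_space hausdorff1 (sphere 0 q)"

lemma space_arc_measure [simp]: "space (arc_measure q) = sphere 0 q"
  by (simp add: space_restrict_space)

lemma measurable_arc_measure: "f \<in> borel_measurable borel \<Longrightarrow> f \<in> borel_measurable (arc_measure q)"
  by (rule measurable_restrict_space1) (simp cong: measurable_cong_sets)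

lemma finite_measure_arc_measure: "q > 0 \<Longrightarrow> finite_measure (arc_measure q)"
  using hausdorff1_sphere_finite[of q]
  by (intro finite_measureI) (simp add: emeasure_restrict_space)

lemma measure_arc_measure_pos: "q > 0 \<Longrightarrow> 0 < measure (arc_measure q) (sphere 0 q)"
  using hausdorff1_sphere_finite[of q] hausdorff1_sphere_pos[of q]
  by (subst measure_restrict_space) (auto simp: measure_def enn2real_positive_iff)

lemma integral_arc_measure_rotate2:
  fixes g :: "real^2 \<Rightarrow> 'b::{banach, second_countable_topology}"
  assumes [measurable]: "g \<in> borel_measurable borel"
  shows "(\<integral>x. g (rotate2 \<alpha> x) \<partial>arc_measure q) = (\<integral>x. g x \<partial>arc_measure q)"
proof -
  have [measurable]: "sphere (0::real^2) q \<in> sets borel" by (simp add: borel_closed)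
  have "(\<integral>x. g x \<partial>arc_measure q) = (\<integral>x. indicator (sphere 0 q) x *\<^sub>R g x \<partial>hausdorff1)"
    by (subst integral_restrict_space) auto
  also have "\<dots> = (\<integral>x. indicator (sphere 0 q) x *\<^sub>R g x \<partial>distr hausdorff1 borel (rotate2 \<alpha>))"
    by (simp only: hausdorff1_distr_rotate2)
  also have "\<dots> = (\<integral>x. indicator (sphere 0 q) (rotate2 \<alpha> x) *\<^sub>R g (rotate2 \<alpha> x) \<partial>hausdorff1)"
    by (rule integral_distr) (simp_all cong: measurable_cong_sets)
  also have "\<dots> = (\<integral>x. indicator (sphere 0 q) x *\<^sub>R g (rotate2 \<alpha> x) \<partial>hausdorff1)"
    by (simp add: indicator_def)
  also have "\<dots> = (\<integral>x. g (rotate2 \<alpha> x) \<partial>arc_measure q)"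
    by (subst integral_restrict_space) auto
  finally show ?thesis ..
qed

text \<open>A rotation-invariant measure annihilates functions that some rotation turns into their
  negatives. This replaces the explicit integration of trigonometric monomials.\<close>

lemma integral_arc_measure_antisymmetric:
  fixes g :: "real^2 \<Rightarrow> complex"
  assumes "g \<in> borel_measurable borel" "\<And>x. g (rotate2 \<alpha> x) = - g x"
  shows "(\<integral>x. g x \<partial>arc_measure q) = 0"
  using integral_arc_measure_rotate2[OF assms(1), where \<alpha>=\<alpha> and q=q] assms(2) by simp

text \<open>The product of the real parts is half the real part of
  \<open>z^n z^m + z^n cnj(z)^m\<close>. The rotation by \<open>\<pi>/(n+m)\<close> changes the sign of the first monomial, the rotation by
  \<open>\<pi>/(n-m)\<close> that of the second.\<close>

lemma integral_Re_power_mult: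
  assumes "q > 0"
  shows "(\<integral>x. Re (to_complex x ^ n) * Re (to_complex x ^ m) \<partial>arc_measure q) =
    (if n = m \<and> n > 0 then q ^ (2 * n) / 2 * measure (arc_measure q) (sphere 0 q) else
     if n = m then measure (arc_measure q) (sphere 0 q) else 0)"
proof -
  interpret finite_measure "arc_measure q" using assms by (rule finite_measure_arc_measure)
  let ?w = to_complex
  have int: "integrable (arc_measure q) (\<lambda>x. ?w x ^ n * ?w x ^ m)"
    "integrable (arc_measure q) (\<lambda>x. ?w x ^ n * cnj (?w x) ^ m)"
    by (intro integrable_const_bound[of _ "q^n*q^m"] measurable_arc_measure;
        auto intro!: AE_I2 borel_measurable_continuous_onI continuous_intros simp: norm_mult norm_power)+
  have "Re (?w x ^ n) * Re (?w x ^ m) = Re (?w x ^ n * ?w x ^ m + ?w x ^ n * cnj (?w x) ^ m) / 2" for x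
    by (simp flip: complex_cnj_power add: field_simps)
  then have "(\<integral>x. Re (?w x ^ n) * Re (?w x ^ m) \<partial>arc_measure q) =
     (\<integral>x. Re (?w x ^ n * ?w x ^ m + ?w x ^ n * cnj (?w x) ^ m) \<partial>arc_measure q) / 2"
    by (simp only: integral_divide_zero)
  also have "\<dots> = Re ((\<integral>x. ?w x ^ n * ?w x ^ m \<partial>arc_measure q) + (\<integral>x. ?w x ^ n * cnj (?w x) ^ m \<partial>arc_measure q)) / 2"
    using int by (subst integral_Re) auto
  finally have "(\<integral>x. Re (?w x ^ n) * Re (?w x ^ m) \<partial>arc_measure q) =
     Re ((\<integral>x. ?w x ^ n * ?w x ^ m \<partial>arc_measure q) + (\<integral>x. ?w x ^ n * cnj (?w x) ^ m \<partial>arc_measure q)) / 2" .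
  moreover have "(\<integral>x. ?w x ^ n * ?w x ^ m \<partial>arc_measure q) = 0" if "n + m > 0"
  proof (rule integral_arc_measure_antisymmetric[where \<alpha>="pi / real (n + m)"])
    have "real (n + m) * (pi / real (n + m)) = pi"
      using that by (simp del: of_nat_add)
    then have "cis (pi / real (n + m)) ^ n * cis (pi / real (n + m)) ^ m = cis pi"
      by (simp only: Complex.DeMoivre cis_mult distrib_right[symmetric] of_nat_add[symmetric])
    then show "?w (rotate2 (pi / real (n + m)) x) ^ n * ?w (rotate2 (pi / real (n + m)) x) ^ m = - (?w x ^ n * ?w x ^ m)" for x
      by (simp add: power_mult_distrib mult_ac)
  qed measurable
  moreover have "(\<integral>x. ?w x ^ n * cnj (?w x) ^ m \<partial>arc_measure q) = 0" if "n \<noteq> m"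
  proof (rule integral_arc_measure_antisymmetric[where \<alpha>="pi / (real n - real m)"])
    have "real n * (pi / (real n - real m)) - real m * (pi / (real n - real m)) = pi"
      using that by (simp only: left_diff_distrib[symmetric]) simp
    then have "cis (pi / (real n - real m)) ^ n * cnj (cis (pi / (real n - real m))) ^ m = cis pi"
      by (simp only: complex_cnj_power[symmetric] Complex.DeMoivre cis_cnj cis_mult mult_minus_right add_uminus_conv_diff)
    then show "?w (rotate2 (pi / (real n - real m)) x) ^ n * cnj (?w (rotate2 (pi / (real n - real m)) x)) ^ m
       = - (?w x ^ n * cnj (?w x) ^ m)" for x
      by (simp add: power_mult_distrib mult_ac)
  qed (intro borel_measurable_continuous_onI continuous_intros)
  moreover have "(\<integral>x. ?w x ^ n * cnj (?w x) ^ m \<partial>arc_measure q) = q ^ (2 * n) * measure (arc_measure q) (sphere 0 q)"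
    if "n = m"
  proof -
    have "?w x ^ n * cnj (?w x) ^ n = of_real (q ^ (2 * n))" if "x \<in> sphere 0 q" for x
      using that by (simp flip: power_mult_distrib add: complex_norm_square[symmetric] power_mult)
    then have "(\<integral>x. ?w x ^ n * cnj (?w x) ^ n \<partial>arc_measure q) = (\<integral>x. of_real (q ^ (2 * n)) \<partial>arc_measure q)"
      by (intro Bochner_Integration.integral_cong) auto
    then show ?thesis using that by (simp add: scaleR_conv_of_real mult.commute)
  qed
  ultimately show ?thesis
    by (cases "n + m > 0"; cases "n = m") auto
qed

text \<open>The boundary density. Its coefficients are summable, yet they decay more slowly than
  every geometric sequence, so that the exponential growth of the resonant modes prevails for every radius below \<open>R^(3/2)\<close>.\<close>

definition source :: "real \<Rightarrow> real^2 \<Rightarrow> real" where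
  "source q x = (\<Sum>j. (1 / (real j + 1)\<^sup>2) * (Re (to_complex x ^ Suc j) / q ^ Suc j))"

lemma summable_source_coeff: "summable (\<lambda>j. 1 / (real j + 1)\<^sup>2)"
  using inverse_squares_sums by (simp add: sums_iff add.commute)

lemma source_term_bound:
  assumes "x \<in> sphere 0 q" "q > 0"
  shows "\<bar>(1 / (real j + 1)\<^sup>2) * (Re (to_complex x ^ Suc j) / q ^ Suc j)\<bar> \<le> 1 / (real j + 1)\<^sup>2"
proof -
  have "\<bar>Re (to_complex x ^ Suc j)\<bar> \<le> q ^ Suc j"
    using abs_Re_le_cmod[of "to_complex x ^ Suc j"] assms by (simp add: norm_power norm_mult)
  then have "\<bar>Re (to_complex x ^ Suc j) / q ^ Suc j\<bar> \<le> 1" using assms by (simp add: abs_divide)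
  then have "\<bar>1 / (real j + 1)\<^sup>2\<bar> * \<bar>Re (to_complex x ^ Suc j) / q ^ Suc j\<bar> \<le> \<bar>1 / (real j + 1)\<^sup>2\<bar> * 1"
    by (intro mult_left_mono) auto
  then show ?thesis by (simp only: abs_mult) simp
qed

lemma borel_measurable_source: "source q \<in> borel_measurable borel"
  unfolding source_def by measurable

lemma abs_source_le:
  assumes "x \<in> sphere 0 q" "q > 0"
  shows "\<bar>source q x\<bar> \<le> (\<Sum>j. 1 / (real j + 1)\<^sup>2)"
  unfolding source_def real_norm_def[symmetric]
  using source_term_bound[OF assms] summable_source_coeff
  by (intro order_trans[OF summable_norm] suminf_le summable_comparison_test'[OF summable_source_coeff]) auto

lemma integrable_source_square:
  assumes "q > 0"
  shows "integrable (arc_measure q) (\<lambda>x. (source q x)\<^sup>2)"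
proof -
  interpret finite_measure "arc_measure q" using assms by (rule finite_measure_arc_measure)
  show ?thesis
  proof (rule integrable_const_bound)
    show "AE x in arc_measure q. norm ((source q x)\<^sup>2) \<le> (\<Sum>j. 1 / (real j + 1)\<^sup>2)\<^sup>2"
      using abs_source_le[OF _ assms] by (intro AE_I2) (simp, metis abs_ge_zero power2_abs power_mono)
    show "(\<lambda>x. (source q x)\<^sup>2) \<in> borel_measurable (arc_measure q)"
      using borel_measurable_source by (intro measurable_arc_measure) measurable
  qed
qed

lemma integral_source_Re_power:
  assumes "q > 0"
  shows "(\<integral>x. source q x * Re (to_complex x ^ k) \<partial>arc_measure q) =
    (if k = 0 then 0 else q ^ k / (2 * (real k)\<^sup>2) * measure (arc_measure q) (sphere 0 q))"
proof -
  interpret finite_measure "arc_measure q" using assms by (rule finite_measure_arc_measure)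
  define L where "L = measure (arc_measure q) (sphere 0 q)"
  define t where "t j x = ((1 / (real j + 1)\<^sup>2) * (Re (to_complex x ^ Suc j) / q ^ Suc j)) * Re (to_complex x ^ k)" for j x
  have bd: "norm (t j x) \<le> 1 / (real j + 1)\<^sup>2 * q ^ k" if "x \<in> sphere 0 q" for j x
    unfolding t_def real_norm_def abs_mult[of _ "Re (to_complex x ^ k)"]
    using source_term_bound[OF that assms, of j] abs_Re_le_cmod[of "to_complex x ^ k"] that
    by (intro mult_mono) (auto simp: norm_power)
  have meas: "t j \<in> borel_measurable (arc_measure q)" for j
    unfolding t_def by (intro measurable_arc_measure) measurable
  have int: "integrable (arc_measure q) (t j)" for j
    using bd by (intro integrable_const_bound[of _ "1 / (real j + 1)\<^sup>2 * q ^ k"] AE_I2 meas) auto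
  have sm: "summable (\<lambda>j. norm (t j x))" if "x \<in> sphere 0 q" for x
    using bd[OF that] by (intro summable_comparison_test'[OF summable_mult2[OF summable_source_coeff, of "q^k"]]) auto
  have smi: "summable (\<lambda>j. \<integral>x. norm (t j x) \<partial>arc_measure q)"
  proof (rule summable_comparison_test'[OF summable_mult2[OF summable_source_coeff, of "q^k * L"]])
    fix j
    have "(\<integral>x. norm (t j x) \<partial>arc_measure q) \<le> (\<integral>x. 1 / (real j + 1)\<^sup>2 * q ^ k \<partial>arc_measure q)"
      using bd int by (intro integral_mono) auto
    then show "norm (\<integral>x. norm (t j x) \<partial>arc_measure q) \<le> 1 / (real j + 1)\<^sup>2 * (q ^ k * L)"
      by (simp add: L_def mult_ac)
  qed
  have "(\<integral>x. source q x * Re (to_complex x ^ k) \<partial>arc_measure q) = (\<integral>x. (\<Sum>j. t j x) \<partial>arc_measure q)"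
  proof (rule Bochner_Integration.integral_cong[OF refl])
    fix x assume "x \<in> space (arc_measure q)"
    then have "summable (\<lambda>j. (1 / (real j + 1)\<^sup>2) * (Re (to_complex x ^ Suc j) / q ^ Suc j))"
      using source_term_bound[OF _ assms] by (intro summable_comparison_test'[OF summable_source_coeff]) auto
    from suminf_mult2[OF this, of "Re (to_complex x ^ k)"]
    show "source q x * Re (to_complex x ^ k) = (\<Sum>j. t j x)" by (simp add: source_def t_def)
  qed
  also have "\<dots> = (\<Sum>j. \<integral>x. t j x \<partial>arc_measure q)"
    using sm by (intro integral_suminf int smi AE_I2) auto
  also have "\<dots> = (\<Sum>j. if Suc j = k then q ^ k / (2 * (real k)\<^sup>2) * L else 0)"
  proof (rule suminf_cong)
    fix j
    have "(\<integral>x. t j x \<partial>arc_measure q) =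
       (1 / (real j + 1)\<^sup>2 / q ^ Suc j) * (\<integral>x. Re (to_complex x ^ Suc j) * Re (to_complex x ^ k) \<partial>arc_measure q)"
      unfolding integral_mult_right_zero[symmetric] by (simp add: t_def mult_ac)
    also have "\<dots> = (if Suc j = k then q ^ k / (2 * (real k)\<^sup>2) * L else 0)"
    proof (cases "Suc j = k")
      case True
      define P where "P = q ^ k"
      have "P \<noteq> 0" using assms by (simp add: P_def)
      moreover have "q ^ (2 * k) = P * P" by (simp add: P_def mult_2 power_add)
      moreover have "real j + 1 = real k" "real k \<noteq> 0" using True by auto
      ultimately show ?thesis
        unfolding integral_Re_power_mult[OF assms] L_def[symmetric]
        using True by (simp add: P_def[symmetric] del: power_Suc)
    next
      case False
      then show ?thesis unfolding integral_Re_power_mult[OF assms] by simp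
    qed
    finally show "(\<integral>x. t j x \<partial>arc_measure q) = (if Suc j = k then q ^ k / (2 * (real k)\<^sup>2) * L else 0)" .
  qed
  also have "\<dots> = (\<Sum>j\<in>{k - 1}. if Suc j = k then q ^ k / (2 * (real k)\<^sup>2) * L else 0)"
    by (rule suminf_finite) auto
  finally show ?thesis by (auto simp: L_def)
qed

section \<open>Smooth functions of one variable\<close>

text \<open>The analogue on the line of the class \<open>C_k\<close> of functions on the plane.\<close>

primrec C_k1 :: "nat \<Rightarrow> (real \<Rightarrow> real) \<Rightarrow> bool" where
  "C_k1 0 f \<longleftrightarrow> continuous_on UNIV f"
| "C_k1 (Suc k) f \<longleftrightarrow> (\<exists>f'. (\<forall>x. (f has_real_derivative f' x) (at x)) \<and> C_k1 k f')"

lemma C_k1_SucI: "(\<And>x. (f has_real_derivative f' x) (at x)) \<Longrightarrow> C_k1 k f' \<Longrightarrow> C_k1 (Suc k) f"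
  by auto

lemma C_k1_SucE:
  assumes "C_k1 (Suc k) f"
  obtains f' where "\<And>x. (f has_real_derivative f' x) (at x)" "C_k1 k f'"
  using assms by auto

lemma C_k1_mono: "C_k1 (Suc k) f \<Longrightarrow> C_k1 k f"
proof (induction k arbitrary: f)
  case 0
  then show ?case by (auto intro!: continuous_at_imp_continuous_on intro: DERIV_isCont)
next
  case (Suc k)
  obtain f' where f': "\<And>x. (f has_real_derivative f' x) (at x)" "C_k1 (Suc k) f'"
    using Suc.prems by (rule C_k1_SucE) (rule that)
  show ?case by (rule C_k1_SucI[OF f'(1)]) (rule Suc.IH[OF f'(2)])
qed

lemma C_k1_add: "C_k1 k f \<Longrightarrow> C_k1 k g \<Longrightarrow> C_k1 k (\<lambda>x. f x + g x)"
proof (induction k arbitrary: f g)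
  case (Suc k)
  obtain f' where f': "\<And>x. (f has_real_derivative f' x) (at x)" "C_k1 k f'" using Suc.prems(1) by (rule C_k1_SucE) (rule that)
  obtain g' where g': "\<And>x. (g has_real_derivative g' x) (at x)" "C_k1 k g'" using Suc.prems(2) by (rule C_k1_SucE) (rule that)
  show ?case by (rule C_k1_SucI[OF DERIV_add[OF f'(1) g'(1)]]) (rule Suc.IH[OF f'(2) g'(2)])
qed (auto intro: continuous_intros)

lemma C_k1_mult: "C_k1 k f \<Longrightarrow> C_k1 k g \<Longrightarrow> C_k1 k (\<lambda>x. f x * g x)"
proof (induction k arbitrary: f g)
  case (Suc k)
  obtain f' where f': "\<And>x. (f has_real_derivative f' x) (at x)" "C_k1 k f'" using Suc.prems(1) by (rule C_k1_SucE) (rule that)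
  obtain g' where g': "\<And>x. (g has_real_derivative g' x) (at x)" "C_k1 k g'" using Suc.prems(2) by (rule C_k1_SucE) (rule that)
  show ?case
    by (rule C_k1_SucI[OF DERIV_mult[OF f'(1) g'(1)]])
      (rule C_k1_add[OF Suc.IH[OF f'(2) C_k1_mono[OF Suc.prems(2)]] Suc.IH[OF g'(2) C_k1_mono[OF Suc.prems(1)]]])
qed (auto intro: continuous_intros)

lemma C_k1_const [simp]: "C_k1 k (\<lambda>x. c)"
proof (induction k arbitrary: c)
  case (Suc k)
  then show ?case by (intro C_k1_SucI[OF DERIV_const])
qed simp

lemma C_k1_id [simp]: "C_k1 k (\<lambda>x. x)"
  by (cases k) (auto simp del: C_k1.simps(2) intro: C_k1_SucI[OF DERIV_ident])

lemma C_k1_compose: "C_k1 k f \<Longrightarrow> C_k1 k g \<Longrightarrow> C_k1 k (\<lambda>x. f (g x))"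
proof (induction k arbitrary: f g)
  case 0
  then show ?case by (auto intro: continuous_on_compose2)
next
  case (Suc k)
  obtain f' where f': "\<And>x. (f has_real_derivative f' x) (at x)" "C_k1 k f'" using Suc.prems(1) by (rule C_k1_SucE) (rule that)
  obtain g' where g': "\<And>x. (g has_real_derivative g' x) (at x)" "C_k1 k g'" using Suc.prems(2) by (rule C_k1_SucE) (rule that)
  show ?case
    by (rule C_k1_SucI[OF DERIV_chain2[OF f'(1) g'(1)]])
      (rule C_k1_mult[OF Suc.IH[OF f'(2) C_k1_mono[OF Suc.prems(2)]] g'(2)])
qed

lemma C_k1_inverse: "C_k1 k f \<Longrightarrow> (\<And>x. f x \<noteq> 0) \<Longrightarrow> C_k1 k (\<lambda>x. inverse (f x))"
proof (induction k arbitrary: f)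
  case (Suc k)
  obtain f' where f': "\<And>x. (f has_real_derivative f' x) (at x)" "C_k1 k f'" using Suc.prems(1) by (rule C_k1_SucE) (rule that)
  have inv: "C_k1 k (\<lambda>x. inverse (f x))" by (intro Suc.IH C_k1_mono[OF Suc.prems(1)] Suc.prems(2))
  have "C_k1 k (\<lambda>x. (- 1) * ((inverse (f x) * f' x) * inverse (f x)))"
    by (intro C_k1_mult inv f' C_k1_const)
  then have "C_k1 k (\<lambda>x. - (inverse (f x) * f' x * inverse (f x)))" by simp
  then show ?case by (rule C_k1_SucI[OF DERIV_inverse'[OF f'(1) Suc.prems(2)]])
qed (auto intro: continuous_intros)

lemma C_k1_exp: "C_k1 k exp"
proof (induction k)
  case (Suc k)
  then show ?case by (intro C_k1_SucI[OF DERIV_exp])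
qed (auto intro: continuous_intros)

lemma C_k1_derivative:
  assumes "C_k1 (Suc k) f" "\<And>x. (f has_real_derivative f' x) (at x)"
  shows "C_k1 k f'"
proof -
  obtain f'' where f'': "\<And>x. (f has_real_derivative f'' x) (at x)" "C_k1 k f''" using assms(1) by (rule C_k1_SucE) (rule that)
  have "f'' = f'" using DERIV_unique[OF f''(1) assms(2)] by (rule ext)
  with f'' show ?thesis by simp
qed

text \<open>The derivatives of \<open>exp (-1/x)\<close>, extended by zero to the left half-line, are linear
  combinations of these functions; so smoothness can be proved for all \<open>n\<close> simultaneously.\<close>

definition exp_tail :: "nat \<Rightarrow> real \<Rightarrow> real" where
  "exp_tail n x = (if x > 0 then (1 / x) ^ n * exp (- (1 / x)) else 0)"

lemma exp_tail_tendsto_0: "(exp_tail n \<longlongrightarrow> 0) (at 0)"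
proof -
  have "((\<lambda>x::real. (1 / x) ^ n / exp (1 / x)) \<longlongrightarrow> 0) (at_right 0)"
    using filterlim_compose[OF tendsto_power_div_exp_0 filterlim_inverse_at_top_right]
    by (simp add: inverse_eq_divide)
  then have "(exp_tail n \<longlongrightarrow> 0) (at_right 0)"
    by (rule Lim_transform_eventually)
      (auto simp: exp_tail_def eventually_at_right_less exp_minus divide_inverse eventually_at_filter)
  moreover have "(exp_tail n \<longlongrightarrow> 0) (at_left 0)"
    by (rule tendsto_eventually) (auto simp: exp_tail_def eventually_at_filter)
  ultimately show ?thesis by (simp add: filterlim_at_split)
qed

lemma has_real_derivative_exp_tail:
  "(exp_tail n has_real_derivative exp_tail (n + 2) x - real n * exp_tail (n + 1) x) (at x)"
proof -
  consider "x > 0" | "x < 0" | "x = 0" by linarith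
  then show ?thesis
  proof cases
    case 1
    have d: "((\<lambda>x. 1 / x) has_real_derivative - (1 / x)\<^sup>2) (at x)"
      using 1 by (auto intro!: derivative_eq_intros simp: field_simps power2_eq_square)
    have p: "((\<lambda>x. (1 / x) ^ n) has_real_derivative - (real n * (1 / x) ^ (n + 1))) (at x)"
      by (rule DERIV_cong[OF DERIV_power[OF d]]) (cases n; simp add: power2_eq_square)
    have e: "((\<lambda>x. exp (- (1 / x))) has_real_derivative exp (- (1 / x)) * (1 / x)\<^sup>2) (at x)"
      using DERIV_fun_exp[OF DERIV_minus[OF d]] by simp
    have "((\<lambda>x. (1 / x) ^ n * exp (- (1 / x))) has_real_derivative
       exp_tail (n + 2) x - real n * exp_tail (n + 1) x) (at x)"
      using 1 by (intro DERIV_cong[OF DERIV_mult[OF p e]])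
        (simp add: exp_tail_def power2_eq_square algebra_simps)
    then show ?thesis
      by (rule has_field_derivative_transform_within_open[of _ _ _ "{0<..}"]) (use 1 in \<open>auto simp: exp_tail_def\<close>)
  next
    case 2
    have "((\<lambda>x. 0) has_real_derivative exp_tail (n + 2) x - real n * exp_tail (n + 1) x) (at x)"
      using 2 by (auto simp: exp_tail_def)
    then show ?thesis
      by (rule has_field_derivative_transform_within_open[of _ _ _ "{..<0}"]) (use 2 in \<open>auto simp: exp_tail_def\<close>)
  next
    case 3
    have "((\<lambda>h. exp_tail n h / h) \<longlongrightarrow> 0) (at 0)"
      using exp_tail_tendsto_0[of "Suc n"]
      by (rule Lim_transform_eventually) (auto simp: exp_tail_def eventually_at_filter)
    then show ?thesis using 3 by (simp add: DERIV_def exp_tail_def)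
  qed
qed

lemma C_k1_exp_tail: "C_k1 k (exp_tail n)"
proof (induction k arbitrary: n)
  case 0
  show ?case
    by (auto intro!: continuous_at_imp_continuous_on intro: DERIV_isCont has_real_derivative_exp_tail)
next
  case (Suc k)
  have "C_k1 k (\<lambda>x. exp_tail (n + 2) x + (- real n) * exp_tail (n + 1) x)"
    by (intro C_k1_add C_k1_mult Suc) simp
  then have "C_k1 k (\<lambda>x. exp_tail (n + 2) x - real n * exp_tail (n + 1) x)" by simp
  then show ?case by (rule C_k1_SucI[OF has_real_derivative_exp_tail])
qed

definition smooth_step :: "real \<Rightarrow> real" where
  "smooth_step t = exp_tail 0 t * inverse (exp_tail 0 t + exp_tail 0 (1 - t))"

lemma smooth_step_denom_pos: "exp_tail 0 t + exp_tail 0 (1 - t) > 0"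
  by (auto simp: exp_tail_def add_pos_pos)

lemma C_k1_smooth_step: "C_k1 k smooth_step"
proof -
  have "C_k1 k (\<lambda>t. exp_tail 0 (1 + (-1) * t))"
    by (intro C_k1_compose[OF C_k1_exp_tail] C_k1_add C_k1_mult C_k1_const C_k1_id)
  then have "C_k1 k (\<lambda>t. exp_tail 0 (1 - t))" by simp
  moreover have "exp_tail 0 t + exp_tail 0 (1 - t) \<noteq> 0" for t
    using smooth_step_denom_pos[of t] by simp
  ultimately show ?thesis
    unfolding smooth_step_def by (intro C_k1_mult C_k1_inverse C_k1_add C_k1_exp_tail)
qed

lemma smooth_step_0: "t \<le> 0 \<Longrightarrow> smooth_step t = 0"
  and smooth_step_1: "t \<ge> 1 \<Longrightarrow> smooth_step t = 1"
  and smooth_step_ge: "0 \<le> smooth_step t"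
  and smooth_step_le: "smooth_step t \<le> 1"
proof -
  have nn: "exp_tail 0 t \<ge> 0" for t by (simp add: exp_tail_def)
  show "t \<le> 0 \<Longrightarrow> smooth_step t = 0" by (simp add: smooth_step_def exp_tail_def)
  show "t \<ge> 1 \<Longrightarrow> smooth_step t = 1" by (simp add: smooth_step_def exp_tail_def)
  show "0 \<le> smooth_step t" using nn by (simp add: smooth_step_def)
  show "smooth_step t \<le> 1"
    unfolding smooth_step_def divide_inverse[symmetric] divide_le_eq_1
    using nn[of "1 - t"] smooth_step_denom_pos[of t] by linarith
qed

text \<open>The antiderivative is normalized to vanish where \<open>\<l>\<close> is required to vanish, so
  that integration may start at 0 although the derivative is needed on the whole line.\<close>

lemma smooth_antiderivative_from_0:
  fixes \<l> :: "real \<Rightarrow> real"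
  assumes cont: "continuous_on UNIV \<l>" and zero: "\<And>s. s \<le> a \<Longrightarrow> \<l> s = 0" and "a > 0"
  obtains L where "\<And>s. (L has_real_derivative \<l> s) (at s)" "\<And>s. s \<le> a \<Longrightarrow> L s = 0"
proof
  define L where "L s = integral {0..s} \<l>" for s
  have L0: "L s = 0" if "s \<le> a" for s
    unfolding L_def using integral_cong[of "{0..s}" \<l> "\<lambda>_. 0"] zero that by simp
  show "L s = 0" if "s \<le> a" for s by (rule L0[OF that])
  show "(L has_real_derivative \<l> s) (at s)" for s
  proof (cases "s < a")
    case True
    have "((\<lambda>_. 0) has_real_derivative \<l> s) (at s)" using True zero by simp
    then show ?thesis
      by (rule has_field_derivative_transform_within_open[of _ _ _ "{..<a}"]) (use True L0 in auto)
  next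
    case False
    have "(L has_real_derivative \<l> s) (at s within {0..s + 1})"
      unfolding L_def using False \<open>a > 0\<close>
      by (intro integral_has_real_derivative continuous_on_subset[OF cont]) auto
    then show ?thesis
      using False \<open>a > 0\<close> by (subst (asm) at_within_interior) auto
  qed
qed

section \<open>Smooth modes in the plane\<close>

lemma partial_deriv_eq: "(\<phi> has_derivative D) (at x) \<Longrightarrow> partial_deriv i \<phi> x = D (axis i 1)"
  unfolding partial_deriv_def by (metis frechet_derivative_at)

lemma C_k_SucI:
  assumes "\<And>x. (\<phi> has_derivative D x) (at x)" "\<And>i. C_k k (\<lambda>x. D x (axis i 1))"
  shows "C_k (Suc k) \<phi>"
proof -
  have "partial_deriv i \<phi> = (\<lambda>x. D x (axis i 1))" for i
    using partial_deriv_eq[OF assms(1)] by blast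
  with assms show ?thesis by (auto simp: differentiable_def)
qed

lemma C_k_SucE:
  assumes "C_k (Suc k) \<phi>"
  obtains D where "\<And>x. (\<phi> has_derivative D x) (at x)" "\<And>i. C_k k (\<lambda>x. D x (axis i 1))"
proof
  show "(\<phi> has_derivative frechet_derivative \<phi> (at x)) (at x)" for x
    using assms by (simp add: frechet_derivative_works)
  show "C_k k (\<lambda>x. frechet_derivative \<phi> (at x) (axis i 1))" for i
    using assms by (simp add: partial_deriv_def[abs_def])
qed

lemma C_k_mono: "C_k (Suc k) \<phi> \<Longrightarrow> C_k k \<phi>"
proof (induction k arbitrary: \<phi>)
  case 0
  then show ?case
    by (auto intro!: continuous_at_imp_continuous_on differentiable_imp_continuous_within)
next
  case (Suc k)
  then show ?case by (metis C_k.simps(2))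
qed

lemma C_k_add: "C_k k \<phi> \<Longrightarrow> C_k k \<psi> \<Longrightarrow> C_k k (\<lambda>x. \<phi> x + \<psi> x)"
proof (induction k arbitrary: \<phi> \<psi>)
  case (Suc k)
  obtain D where D: "\<And>x. (\<phi> has_derivative D x) (at x)" "\<And>i. C_k k (\<lambda>x. D x (axis i 1))"
    using Suc.prems(1) by (rule C_k_SucE) (rule that)
  obtain E where E: "\<And>x. (\<psi> has_derivative E x) (at x)" "\<And>i. C_k k (\<lambda>x. E x (axis i 1))"
    using Suc.prems(2) by (rule C_k_SucE) (rule that)
  show ?case by (rule C_k_SucI[OF has_derivative_add[OF D(1) E(1)]]) (rule Suc.IH[OF D(2) E(2)])
qed (auto intro: continuous_intros)

lemma C_k_mult: "C_k k \<phi> \<Longrightarrow> C_k k \<psi> \<Longrightarrow> C_k k (\<lambda>x. \<phi> x * \<psi> x)"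
proof (induction k arbitrary: \<phi> \<psi>)
  case (Suc k)
  obtain D where D: "\<And>x. (\<phi> has_derivative D x) (at x)" "\<And>i. C_k k (\<lambda>x. D x (axis i 1))"
    using Suc.prems(1) by (rule C_k_SucE) (rule that)
  obtain E where E: "\<And>x. (\<psi> has_derivative E x) (at x)" "\<And>i. C_k k (\<lambda>x. E x (axis i 1))"
    using Suc.prems(2) by (rule C_k_SucE) (rule that)
  show ?case
    by (rule C_k_SucI[OF has_derivative_mult[OF D(1) E(1)]])
      (rule C_k_add[OF Suc.IH[OF C_k_mono[OF Suc.prems(1)] E(2)] Suc.IH[OF D(2) C_k_mono[OF Suc.prems(2)]]])
qed (auto intro: continuous_intros)

lemma C_k_const: "C_k k (\<lambda>x. c)"
proof (induction k arbitrary: c)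
  case (Suc k)
  then show ?case by (intro C_k_SucI[OF has_derivative_const])
qed simp

lemma C_k_component: "C_k k (\<lambda>x. x $ j)"
proof (cases k)
  case (Suc k)
  have "((\<lambda>x :: real^2. x $ j) has_derivative (\<lambda>h. h $ j)) (at x)" for x
    by (intro bounded_linear_imp_has_derivative bounded_linear_vec_nth)
  then show ?thesis unfolding Suc by (rule C_k_SucI) (rule C_k_const)
qed (auto intro: continuous_intros)

lemma C_k_compose: "C_k1 k f \<Longrightarrow> C_k k \<phi> \<Longrightarrow> C_k k (\<lambda>x. f (\<phi> x))"
proof (induction k arbitrary: f \<phi>)
  case 0
  then show ?case by (auto intro: continuous_on_compose2)
next
  case (Suc k)
  obtain f' where f': "\<And>x. (f has_real_derivative f' x) (at x)" "C_k1 k f'"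
    using Suc.prems(1) by (rule C_k1_SucE) (rule that)
  obtain D where D: "\<And>x. (\<phi> has_derivative D x) (at x)" "\<And>i. C_k k (\<lambda>x. D x (axis i 1))"
    using Suc.prems(2) by (rule C_k_SucE) (rule that)
  show ?case
    by (rule C_k_SucI[OF DERIV_compose_FDERIV[OF f'(1) D(1)]])
      (rule C_k_mult[OF D(2) Suc.IH[OF f'(2) C_k_mono[OF Suc.prems(2)]]])
qed

lemma C_k_radial: "C_k1 k g \<Longrightarrow> C_k k (\<lambda>x. g ((norm x)\<^sup>2))"
proof -
  assume "C_k1 k g"
  then have "C_k k (\<lambda>x. g (x $ 1 * x $ 1 + x $ 2 * x $ 2))"
    by (rule C_k_compose) (intro C_k_add C_k_mult C_k_component)
  then show ?thesis
    by (simp add: norm_eq_sqrt_inner inner_vec_def sum_2)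
qed

lemma C_k_Re_Im_power: "C_k k (\<lambda>x. Re (to_complex x ^ n)) \<and> C_k k (\<lambda>x. Im (to_complex x ^ n))"
proof (induction n)
  case 0
  show ?case by (simp add: C_k_const)
next
  case (Suc n)
  have "C_k k (\<lambda>x. x $ 1 * Re (to_complex x ^ n) + (- 1) * (x $ 2 * Im (to_complex x ^ n)))"
    "C_k k (\<lambda>x. x $ 1 * Im (to_complex x ^ n) + x $ 2 * Re (to_complex x ^ n))"
    using Suc by (intro C_k_add C_k_mult C_k_const C_k_component; simp)+
  then show ?case by (simp add: to_complex_def)
qed

text \<open>The functions \<open>g(r\<^sup>2) Re z^n\<close> and \<open>g(r\<^sup>2) Im z^n\<close>. In terms of \<open>r\<^sup>2\<close>, and not of \<open>r\<close>, the radial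
  factor is smooth at the origin as soon as \<open>g\<close> is smooth.\<close>

definition mode_re :: "(real \<Rightarrow> real) \<Rightarrow> nat \<Rightarrow> real^2 \<Rightarrow> real" where
  "mode_re g n x = g ((norm x)\<^sup>2) * Re (to_complex x ^ n)"

definition mode_im :: "(real \<Rightarrow> real) \<Rightarrow> nat \<Rightarrow> real^2 \<Rightarrow> real" where
  "mode_im g n x = g ((norm x)\<^sup>2) * Im (to_complex x ^ n)"

lemma test_fun_mode:
  assumes "\<And>k. C_k1 k g" "\<And>s. M\<^sup>2 \<le> s \<Longrightarrow> g s = 0" "0 \<le> M"
  shows "test_fun (mode_re g n)" "test_fun (mode_im g n)"
proof -
  have "bounded {x. mode_re g n x \<noteq> 0}" "bounded {x. mode_im g n x \<noteq> 0}"
    by (rule bounded_subset[OF bounded_cball[of 0 M]];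
      auto simp: mode_re_def mode_im_def; metis assms(2,3) linear norm_ge_zero power_mono)+
  then show "test_fun (mode_re g n)" "test_fun (mode_im g n)"
    using assms(1) C_k_Re_Im_power unfolding test_fun_def mode_re_def[abs_def] mode_im_def[abs_def]
    by (simp_all add: C_k_mult C_k_radial compact_closure)
qed

lemma has_derivative_radial:
  assumes "\<And>s. (g has_real_derivative g' s) (at s)"
  shows "((\<lambda>x :: real^2. g ((norm x)\<^sup>2)) has_derivative (\<lambda>h. 2 * (x $ 1 * h $ 1 + x $ 2 * h $ 2) * g' ((norm x)\<^sup>2))) (at x)"
proof -
  have "((\<lambda>x :: real^2. (norm x)\<^sup>2) has_derivative (\<lambda>h. 2 * (x $ 1 * h $ 1 + x $ 2 * h $ 2))) (at x)"
    unfolding power2_norm_eq_inner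
    by (rule has_derivative_eq_rhs[OF has_derivative_inner[OF has_derivative_ident has_derivative_ident]])
      (simp add: fun_eq_iff inner_vec_def sum_2)
  from DERIV_compose_FDERIV[OF assms this] show ?thesis .
qed

lemma has_derivative_power_to_complex:
  "((\<lambda>x. to_complex x ^ n) has_derivative (\<lambda>h. of_nat n * to_complex x ^ (n - 1) * to_complex h)) (at x)"
proof -
  have "linear to_complex" by (rule linearI) (simp_all add: to_complex_def complex_eq_iff)
  then have "(to_complex has_derivative to_complex) (at x)"
    by (rule bounded_linear_imp_has_derivative[OF linear_conv_bounded_linear[THEN iffD1]])
  from has_derivative_power[OF this, of n] show ?thesis
    by (simp add: mult_ac)
qed

lemma has_derivative_mode:
  assumes "\<And>s. (g has_real_derivative g' s) (at s)"
  shows "(mode_re g n has_derivative (\<lambda>h.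
      h $ 1 * (real n * mode_re g (n - 1) x + 2 * x $ 1 * mode_re g' n x)
    + h $ 2 * (- real n * mode_im g (n - 1) x + 2 * x $ 2 * mode_re g' n x))) (at x)" (is ?re)
  and "(mode_im g n has_derivative (\<lambda>h.
      h $ 1 * (real n * mode_im g (n - 1) x + 2 * x $ 1 * mode_im g' n x)
    + h $ 2 * (real n * mode_re g (n - 1) x + 2 * x $ 2 * mode_im g' n x))) (at x)" (is ?im)
proof -
  note r = has_derivative_radial[OF assms, of x]
  note re = has_derivative_Re[OF has_derivative_power_to_complex, of n x]
  note im = has_derivative_Im[OF has_derivative_power_to_complex, of n x]
  have of_nat: "Re (of_nat n * w) = real n * Re w" "Im (of_nat n * w) = real n * Im w" for w
    by simp_all
  show ?re
    unfolding mode_re_def mode_im_def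
    by (rule has_derivative_eq_rhs[OF has_derivative_mult[OF r re]])
      (simp add: fun_eq_iff mult.assoc of_nat del: of_nat_mult, simp add: to_complex_def algebra_simps)
  show ?im
    unfolding mode_re_def mode_im_def
    by (rule has_derivative_eq_rhs[OF has_derivative_mult[OF r im]])
      (simp add: fun_eq_iff mult.assoc of_nat del: of_nat_mult, simp add: to_complex_def algebra_simps)
qed

lemma partial_deriv_mode:
  assumes "\<And>s. (g has_real_derivative g' s) (at s)"
  shows "partial_deriv 1 (mode_re g n) x = real n * mode_re g (n - 1) x + 2 * x $ 1 * mode_re g' n x"
    "partial_deriv 2 (mode_re g n) x = - real n * mode_im g (n - 1) x + 2 * x $ 2 * mode_re g' n x"
    "partial_deriv 1 (mode_im g n) x = real n * mode_im g (n - 1) x + 2 * x $ 1 * mode_im g' n x"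
    "partial_deriv 2 (mode_im g n) x = real n * mode_re g (n - 1) x + 2 * x $ 2 * mode_im g' n x"
  using has_derivative_mode[OF assms, of n x] by (simp_all add: partial_deriv_eq axis_def)

text \<open>Symmetry of the second derivatives, which makes the weak gradient of a solution curl-free
  when tested with the conjugate mode.\<close>

lemma partial_deriv_mode_commute:
  assumes g: "\<And>s. (g has_real_derivative g' s) (at s)" and g': "\<And>s. (g' has_real_derivative g'' s) (at s)"
  shows "partial_deriv 1 (partial_deriv 2 (mode_im g n)) = partial_deriv 2 (partial_deriv 1 (mode_im g n))"
proof
  fix x :: "real^2"
  have c: "((\<lambda>x :: real^2. x $ j) has_derivative (\<lambda>h. h $ j)) (at x)" for j
    by (intro bounded_linear_imp_has_derivative bounded_linear_vec_nth)
  have p: "partial_deriv 1 (mode_im g n) = (\<lambda>x. real n * mode_im g (n - 1) x + 2 * x $ 1 * mode_im g' n x)"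
    "partial_deriv 2 (mode_im g n) = (\<lambda>x. real n * mode_re g (n - 1) x + 2 * x $ 2 * mode_im g' n x)"
    by (rule ext, rule partial_deriv_mode[OF g])+
  show "partial_deriv 1 (partial_deriv 2 (mode_im g n)) x = partial_deriv 2 (partial_deriv 1 (mode_im g n)) x"
    unfolding p
    by (subst partial_deriv_eq[OF has_derivative_add[OF has_derivative_mult_right[OF has_derivative_mode(1)[OF g]]
        has_derivative_mult[OF has_derivative_mult_right[OF c] has_derivative_mode(2)[OF g']]]],
        subst partial_deriv_eq[OF has_derivative_add[OF has_derivative_mult_right[OF has_derivative_mode(2)[OF g]]
        has_derivative_mult[OF has_derivative_mult_right[OF c] has_derivative_mode(2)[OF g']]]])
      (simp add: axis_def algebra_simps)
qed

section \<open>The radial profile of a smoothed plasmon\<close>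

text \<open>The cutoff of the modes uses an interval \<open>[a, b]\<close> that is the same for all orders \<open>k\<close>, and hence
  one bound \<open>K\<close> for \<open>s \<tau>'(s)\<close>, the form in which the derivative enters the flux defect.\<close>

lemma smooth_cutoff:
  assumes "0 < (a::real)" "a < b"
  obtains \<tau> \<tau>' K where "\<And>n. C_k1 n \<tau>" "\<And>s. (\<tau> has_real_derivative \<tau>' s) (at s)"
    "\<And>s. 0 \<le> \<tau> s" "\<And>s. \<tau> s \<le> 1" "\<And>s. s \<le> a \<Longrightarrow> \<tau> s = 1" "\<And>s. b \<le> s \<Longrightarrow> \<tau> s = 0"
    "\<And>s. s < a \<Longrightarrow> \<tau>' s = 0" "\<And>s. b < s \<Longrightarrow> \<tau>' s = 0" "0 \<le> K" "\<And>s. \<bar>s * \<tau>' s\<bar> \<le> K"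
proof -
  define \<tau> where "\<tau> s = 1 + (-1) * smooth_step ((s + (- a)) * (1 / (b - a)))" for s
  have smooth: "C_k1 n \<tau>" for n
    unfolding \<tau>_def
    by (intro C_k1_add C_k1_mult C_k1_const C_k1_compose[OF C_k1_smooth_step] C_k1_id)
  obtain \<tau>' where \<tau>': "\<And>s. (\<tau> has_real_derivative \<tau>' s) (at s)" "C_k1 0 \<tau>'"
    using smooth[of "Suc 0"] by (rule C_k1_SucE) (rule that)
  have 1: "\<tau> s = 1" if "s \<le> a" for s
    using that assms by (simp add: \<tau>_def smooth_step_0 divide_nonpos_pos)
  have 0: "\<tau> s = 0" if "b \<le> s" for s
    using that assms by (simp add: \<tau>_def smooth_step_1 field_simps)
  have flat: "\<tau>' s = 0" if "open S" "s \<in> S" "\<And>t. t \<in> S \<Longrightarrow> \<tau> t = c" for S s c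
  proof -
    have "(\<tau> has_real_derivative 0) (at s)"
      by (rule has_field_derivative_transform_within_open[OF DERIV_const[of c] that(1,2)]) (simp add: that(3))
    with \<tau>'(1) show ?thesis by (rule DERIV_unique)
  qed
  have f1: "\<tau>' s = 0" if "s < a" for s using flat[of "{..<a}" s 1] that 1 by simp
  have f0: "\<tau>' s = 0" if "b < s" for s using flat[of "{b<..}" s 0] that 0 by simp
  have "compact ((\<lambda>s. s * \<tau>' s) ` {a..b})"
    using \<tau>'(2) by (intro compact_continuous_image continuous_intros) (auto intro: continuous_on_subset)
  then obtain K where "\<forall>y\<in>(\<lambda>s. s * \<tau>' s) ` {a..b}. norm y \<le> K"
    using compact_imp_bounded bounded_iff by blast
  then have K: "\<bar>s * \<tau>' s\<bar> \<le> K" if "s \<in> {a..b}" for s using that by simp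
  have "0 \<le> K" using K[of a] assms by (intro order_trans[OF abs_ge_zero]) auto
  moreover have "\<bar>s * \<tau>' s\<bar> \<le> K" for s
    using K[of s] f1[of s] f0[of s] \<open>0 \<le> K\<close> by (cases "s < a"; cases "b < s") auto
  moreover have "0 \<le> \<tau> s" "\<tau> s \<le> 1" for s
    using smooth_step_ge smooth_step_le by (simp_all add: \<tau>_def)
  ultimately show thesis using that[OF smooth \<tau>'(1)] 0 1 f0 f1 by blast
qed

text \<open>A smooth substitute for \<open>max 0 (ln (s/a))\<close>: its derivative \<open>l\<close> is
  the smooth step on \<open>[a, a+d]\<close> divided by \<open>s\<close>.\<close>

lemma smooth_logarithm:
  assumes "1 \<le> (a::real)" "0 < d"
  obtains L l where "\<And>n. C_k1 n L" "\<And>s. (L has_real_derivative l s) (at s)"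
    "\<And>s. s \<le> a \<Longrightarrow> L s = 0" "\<And>s. s \<le> a \<Longrightarrow> l s = 0"
    "\<And>s. a \<le> s \<Longrightarrow> 0 \<le> l s" "\<And>s. a \<le> s \<Longrightarrow> s * l s \<le> 1" "\<And>s. a + d \<le> s \<Longrightarrow> s * l s = 1"
proof -
  \<comment> \<open>\<open>r\<close> is a positive smooth function on the line with \<open>r s = s\<close> for \<open>s \<ge> 1\<close>, so that \<open>1 / r\<close> is smooth.\<close>
  define r where "r s = 1 + smooth_step s * (s + (-1))" for s
  define l where "l s = smooth_step ((s + (- a)) * (1 / d)) * inverse (r s)" for s
  have r_pos: "r s > 0" for s
  proof (cases "s \<le> 0")
    case False
    have "r s = (1 - smooth_step s) + smooth_step s * s" by (simp add: r_def algebra_simps)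
    moreover have "smooth_step s = 0 \<or> smooth_step s * s > 0"
      using False smooth_step_ge[of s] by (cases "smooth_step s = 0") auto
    ultimately show ?thesis using smooth_step_le[of s] by force
  qed (simp add: r_def smooth_step_0)
  have r1: "r s = s" if "1 \<le> s" for s using that by (simp add: r_def smooth_step_1)
  have sl: "C_k1 n l" for n
    unfolding l_def r_def using r_pos[unfolded r_def]
    by (intro C_k1_add C_k1_mult C_k1_const C_k1_compose[OF C_k1_smooth_step] C_k1_id
        C_k1_smooth_step C_k1_inverse) (simp add: order_less_imp_not_eq2)
  have l0: "l s = 0" if "s \<le> a" for s
    using that assms by (simp add: l_def smooth_step_0 divide_nonpos_pos)
  have "continuous_on UNIV l" using sl[of 0] by simp
  then obtain L where L: "\<And>s. (L has_real_derivative l s) (at s)" "\<And>s. s \<le> a \<Longrightarrow> L s = 0"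
    using smooth_antiderivative_from_0[of l a] l0 assms by auto
  have sL: "C_k1 n L" for n
    using C_k1_mono[OF C_k1_SucI[OF L(1) sl]] .
  have rl: "s * l s = smooth_step ((s + (- a)) * (1 / d))" if "a \<le> s" for s
    using that assms by (simp add: l_def r1)
  show thesis
  proof (rule that[OF sL L(1) L(2) l0])
    show "0 \<le> l s" for s using r_pos[of s] smooth_step_ge by (simp add: l_def)
    show "s * l s \<le> 1" if "a \<le> s" for s using smooth_step_le by (simp add: rl[OF that])
    show "s * l s = 1" if "a + d \<le> s" for s
      using that assms by (subst rl) (auto intro!: smooth_step_1 simp: field_simps)
  qed
qed

text \<open>The radial factor \<open>g\<close> of a smoothed plasmon, as a function of \<open>s = r\<^sup>2\<close>. The exact plasmon has
  \<open>g = 1\<close> for \<open>s \<le> R\<^sup>2\<close> and \<open>g = R^(2k) / s^k\<close> beyond. The quantity \<open>k g + s g'\<close> is the one that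
  measures how far \<open>g\<close> is from a multiple of \<open>s^(-k)\<close>, that is, how far the mode
  is from being harmonic outside the disk. The thickness \<open>\<delta>\<close> of the smoothing layer is at most \<open>R^(-2k)\<close>, which compensates
  the size of the squared gradient in the layer.\<close>

definition plasmon_profile :: "real \<Rightarrow> real \<Rightarrow> nat \<Rightarrow> (real \<Rightarrow> real) \<Rightarrow> (real \<Rightarrow> real) \<Rightarrow> real \<Rightarrow> bool" where
  "plasmon_profile R K k g g' \<delta> \<longleftrightarrow> (\<forall>n. C_k1 n g) \<and> (\<forall>s. (g has_real_derivative g' s) (at s)) \<and>
       0 < \<delta> \<and> \<delta> * R ^ (2 * k) \<le> 1 \<and>
       (\<forall>s\<le>R\<^sup>2. g s = 1 \<and> g' s = 0) \<and>
       (\<forall>s\<ge>R\<^sup>2. 0 \<le> g s \<and> g s * s ^ k \<le> 2 * R ^ (2 * k)) \<and>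
       (\<forall>s\<ge>R\<^sup>2. s \<le> R ^ 4 \<longrightarrow> R ^ (2 * k) \<le> g s * s ^ k) \<and>
       (\<forall>s\<ge>R\<^sup>2. \<bar>s * g' s\<bar> * s ^ k \<le> (real k + K) * (2 * R ^ (2 * k))) \<and>
       (\<forall>s\<ge>R\<^sup>2 + \<delta>. \<bar>real k * g s + s * g' s\<bar> * s ^ k \<le> K * (2 * R ^ (2 * k))) \<and>
       (\<forall>s\<ge>R\<^sup>2 + \<delta>. s < R ^ 4 \<longrightarrow> real k * g s + s * g' s = 0) \<and>
       (\<forall>s\<ge>4 * R ^ 4. g s = 0) \<and> (\<forall>s>4 * R ^ 4. g' s = 0)"

text \<open>The profile is \<open>\<tau> exp (-k L)\<close>, with the smoothed logarithm \<open>L\<close> and a cutoff \<open>\<tau>\<close>. The function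
  \<open>s^k exp (-k L(s))\<close> is nondecreasing for \<open>s \<ge> R\<^sup>2\<close>, and it is constant from \<open>R\<^sup>2 + \<delta>\<close> on, so it stays between
  \<open>R^(2k)\<close> and \<open>(R\<^sup>2 + \<delta>)^k\<close>.\<close>

lemma radial_profile:
  assumes "1 < (R::real)"
  obtains K where "0 \<le> K"
    "\<And>k::nat. \<exists>g g' \<delta>. plasmon_profile R K k g g' \<delta>"
proof -
  have R4: "0 < R ^ 4" "R ^ 4 < 4 * R ^ 4" "R\<^sup>2 < R ^ 4" "1 < R\<^sup>2"
    using assms by (auto simp: power_strict_increasing one_less_power)
  obtain \<tau> \<tau>' K where \<tau>: "\<And>n. C_k1 n \<tau>" "\<And>s. (\<tau> has_real_derivative \<tau>' s) (at s)"
    "\<And>s. 0 \<le> \<tau> s" "\<And>s. \<tau> s \<le> 1" "\<And>s. s \<le> R ^ 4 \<Longrightarrow> \<tau> s = 1" "\<And>s. 4 * R ^ 4 \<le> s \<Longrightarrow> \<tau> s = 0"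
    "\<And>s. s < R ^ 4 \<Longrightarrow> \<tau>' s = 0" "\<And>s. 4 * R ^ 4 < s \<Longrightarrow> \<tau>' s = 0" "0 \<le> K" "\<And>s. \<bar>s * \<tau>' s\<bar> \<le> K"
    by (rule smooth_cutoff[OF R4(1,2)]) (rule that)
  have main: "\<exists>g g' \<delta>. plasmon_profile R K k g g' \<delta>" for k :: nat
  proof -
    \<comment> \<open>\<open>\<delta>\<close> is chosen so small that passing the layer changes the size of the plasmon at most by a factor 2.\<close>
    have "((\<lambda>\<delta>. (R\<^sup>2 + \<delta>) ^ k) \<longlongrightarrow> (R\<^sup>2 + 0) ^ k) (at_right 0)"
      and "((\<lambda>\<delta>. \<delta> * R ^ (2 * k)) \<longlongrightarrow> 0 * R ^ (2 * k)) (at_right 0)"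
      by (intro tendsto_intros)+
    moreover have "(R\<^sup>2 + 0) ^ k < 2 * R ^ (2 * k)" using assms by (simp add: power_mult)
    moreover have "0 * R ^ (2 * k) < 1" by simp
    ultimately have "\<forall>\<^sub>F \<delta> in at_right 0. (R\<^sup>2 + \<delta>) ^ k < 2 * R ^ (2 * k) \<and> \<delta> * R ^ (2 * k) < 1 \<and> 0 < \<delta>"
      by (intro eventually_conj order_tendstoD(2) eventually_at_right_less) auto
    then obtain \<delta> where \<delta>: "(R\<^sup>2 + \<delta>) ^ k < 2 * R ^ (2 * k)" "\<delta> * R ^ (2 * k) < 1" "0 < \<delta>"
      by (metis (mono_tags, lifting) eventually_happens trivial_limit_at_right_real)
    obtain L l where L: "\<And>n. C_k1 n L" "\<And>s. (L has_real_derivative l s) (at s)"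
      "\<And>s. s \<le> R\<^sup>2 \<Longrightarrow> L s = 0" "\<And>s. s \<le> R\<^sup>2 \<Longrightarrow> l s = 0"
      "\<And>s. R\<^sup>2 \<le> s \<Longrightarrow> 0 \<le> l s" "\<And>s. R\<^sup>2 \<le> s \<Longrightarrow> s * l s \<le> 1" "\<And>s. R\<^sup>2 + \<delta> \<le> s \<Longrightarrow> s * l s = 1"
      by (rule smooth_logarithm[OF less_imp_le[OF R4(4)] \<delta>(3)]) (rule that)
    define G where "G s = exp ((- real k) * L s)" for s
    have G_pos: "G s > 0" for s by (simp add: G_def)
    have sG: "C_k1 n G" for n
      unfolding G_def by (intro C_k1_compose[OF C_k1_exp] C_k1_mult C_k1_const L)
    have dG: "(G has_real_derivative - (real k * l s * G s)) (at s)" for s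
      unfolding G_def using DERIV_fun_exp[OF DERIV_cmult[OF L(2)[of s], of "- real k"]] by (simp add: mult_ac)
    have L_nonneg: "0 \<le> L s" if "R\<^sup>2 \<le> s" for s
    proof -
      have "L (R\<^sup>2) \<le> L s"
        by (rule DERIV_nonneg_imp_nondecreasing[OF that]) (use L(2,5) in blast)
      then show ?thesis using L(3) by simp
    qed
    have G_le: "G s \<le> 1" if "R\<^sup>2 \<le> s" for s using L_nonneg[OF that] by (simp add: G_def)
    have dH: "((\<lambda>s. G s * s ^ k) has_real_derivative real k * G s * s ^ (k - 1) * (1 - s * l s)) (at s)" for s
      by (rule DERIV_cong[OF DERIV_mult[OF dG DERIV_pow]]) (cases k; simp add: algebra_simps)
    have H_mono: "G s * s ^ k \<le> G t * t ^ k" if "R\<^sup>2 \<le> s" "s \<le> t" for s t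
    proof (rule DERIV_nonneg_imp_nondecreasing[OF that(2)])
      fix x assume x: "s \<le> x" "x \<le> t"
      then have "R\<^sup>2 \<le> x" "0 \<le> x" using that R4 by linarith+
      then show "\<exists>y. ((\<lambda>s. G s * s ^ k) has_real_derivative y) (at x) \<and> 0 \<le> y"
        using L(6)[of x] G_pos[of x]
        by (intro exI[of _ "real k * G x * x ^ (k - 1) * (1 - x * l x)"] conjI dH mult_nonneg_nonneg) auto
    qed
    have H_le: "G s * s ^ k \<le> 2 * R ^ (2 * k)" if "R\<^sup>2 \<le> s" for s
    proof (cases "s \<le> R\<^sup>2 + \<delta>")
      case True
      have "G s * s ^ k \<le> 1 * (R\<^sup>2 + \<delta>) ^ k"
        using True that G_le[OF that] G_pos[of s] R4 by (intro mult_mono power_mono) auto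
      then show ?thesis using \<delta> by simp
    next
      case False
      then have "G s * s ^ k \<le> G (R\<^sup>2 + \<delta>) * (R\<^sup>2 + \<delta>) ^ k"
      proof (intro DERIV_nonpos_imp_nonincreasing[where f="\<lambda>s. G s * s ^ k"])
        fix x assume "R\<^sup>2 + \<delta> \<le> x"
        then show "\<exists>y. ((\<lambda>s. G s * s ^ k) has_real_derivative y) (at x) \<and> y \<le> 0"
          using dH[of x] L(7)[of x] by (intro exI[of _ 0]) simp
      qed simp
      also have "\<dots> \<le> 1 * (R\<^sup>2 + \<delta>) ^ k"
        using G_le[of "R\<^sup>2 + \<delta>"] \<delta> R4 by (intro mult_right_mono) auto
      finally show ?thesis using \<delta> by simp
    qed
    have H_ge: "R ^ (2 * k) \<le> G s * s ^ k" if "R\<^sup>2 \<le> s" for s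
      using H_mono[of "R\<^sup>2" s] that L(3)[of "R\<^sup>2"] by (simp add: G_def power_mult)
    define g where "g s = \<tau> s * G s" for s
    define g' where "g' s = \<tau> s * - (real k * l s * G s) + \<tau>' s * G s" for s
    have dg: "(g has_real_derivative g' s) (at s)" for s
      unfolding g_def g'_def by (rule DERIV_mult'[OF \<tau>(2) dG])
    have sg: "C_k1 n g" for n unfolding g_def by (intro C_k1_mult \<tau> sG)
    have G_pow_nonneg: "0 \<le> G s * s ^ k" if "R\<^sup>2 \<le> s" for s
      using that G_pos[of s] R4 by (intro mult_nonneg_nonneg) auto
    have c1: "g s = 1 \<and> g' s = 0" if "s \<le> R\<^sup>2" for s
      using that R4 \<tau>(5,7) L(3,4) by (simp add: g_def g'_def G_def)
    have c2: "0 \<le> g s \<and> g s * s ^ k \<le> 2 * R ^ (2 * k)" if "R\<^sup>2 \<le> s" for s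
    proof -
      have "\<tau> s * (G s * s ^ k) \<le> 1 * (2 * R ^ (2 * k))"
        by (rule mult_mono) (use \<tau>(3,4) H_le[OF that] G_pow_nonneg[OF that] in auto)
      then show ?thesis using \<tau>(3) G_pos[of s] by (simp add: g_def mult.assoc)
    qed
    have c3: "R ^ (2 * k) \<le> g s * s ^ k" if "R\<^sup>2 \<le> s" "s \<le> R ^ 4" for s
      using H_ge[OF that(1)] \<tau>(5)[OF that(2)] by (simp add: g_def)
    have c4: "\<bar>s * g' s\<bar> * s ^ k \<le> (real k + K) * (2 * R ^ (2 * k))" if "R\<^sup>2 \<le> s" for s
    proof -
      have "0 < s" using that R4 by linarith
      have "\<bar>\<tau> s * (real k * (s * l s))\<bar> \<le> 1 * (real k * 1)"
        using \<tau>(3,4)[of s] L(5,6)[OF that] \<open>0 < s\<close> unfolding abs_mult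
        by (intro mult_mono) auto
      then have "\<bar>s * \<tau>' s - \<tau> s * (real k * (s * l s))\<bar> \<le> real k + K"
        using \<tau>(10)[of s] by linarith
      moreover have "s * g' s = (s * \<tau>' s - \<tau> s * (real k * (s * l s))) * G s"
        by (simp add: g'_def algebra_simps)
      moreover have "\<bar>G s\<bar> = G s" "0 \<le> s ^ k" using G_pos[of s] \<open>0 < s\<close> by simp_all
      ultimately have "\<bar>s * g' s\<bar> * s ^ k \<le> (real k + K) * (G s * s ^ k)"
        using G_pow_nonneg[OF that] by (simp only: abs_mult mult.assoc) (rule mult_right_mono)
      also have "\<dots> \<le> (real k + K) * (2 * R ^ (2 * k))"
        using H_le[OF that] \<tau>(9) by (intro mult_left_mono) auto
      finally show ?thesis .
    qed
    have c5: "\<bar>real k * g s + s * g' s\<bar> * s ^ k \<le> K * (2 * R ^ (2 * k))" if s: "R\<^sup>2 + \<delta> \<le> s" for s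
    proof -
      have R: "R\<^sup>2 \<le> s" using s \<delta> by simp
      have "real k * g s + s * g' s = real k * \<tau> s * G s * (1 - s * l s) + (s * \<tau>' s) * G s"
        by (simp add: g_def g'_def algebra_simps)
      then have "\<bar>real k * g s + s * g' s\<bar> * s ^ k = \<bar>s * \<tau>' s\<bar> * (G s * s ^ k)"
        using L(7)[OF s] G_pos[of s] by (simp add: abs_mult)
      also have "\<dots> \<le> K * (2 * R ^ (2 * k))"
        by (rule mult_mono) (use \<tau>(9,10) H_le[OF R] G_pow_nonneg[OF R] in auto)
      finally show ?thesis .
    qed
    have c5': "real k * g s + s * g' s = 0" if s: "R\<^sup>2 + \<delta> \<le> s" "s < R ^ 4" for s
    proof -
      have "real k * g s + s * g' s = real k * \<tau> s * G s * (1 - s * l s) + (s * \<tau>' s) * G s"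
        by (simp add: g_def g'_def algebra_simps)
      then show ?thesis using L(7)[OF s(1)] \<tau>(7)[OF s(2)] by simp
    qed
    have c6: "g s = 0" if "4 * R ^ 4 \<le> s" for s using \<tau>(6)[OF that] by (simp add: g_def)
    have c7: "g' s = 0" if "4 * R ^ 4 < s" for s using \<tau>(6,8)[of s] that by (simp add: g'_def)
    show ?thesis unfolding plasmon_profile_def
      by (rule exI[of _ g], rule exI[of _ g'], rule exI[of _ \<delta>], intro conjI allI impI)
        ((rule sg dg \<delta>(3) less_imp_le[OF \<delta>(2)] conjunct1[OF c1] conjunct2[OF c1]
            conjunct1[OF c2] conjunct2[OF c2] c3 c4 c5 c5' c6 c7; assumption)+)
  qed
  show thesis by (rule that[OF \<tau>(9) main])
qed

section \<open>A priori lower bound for weak solutions\<close>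

text \<open>Locally the curve is a differentiable image of an interval.\<close>

lemma negligible_C2_curve:
  assumes "C2_curve \<Gamma>"
  shows "negligible \<Gamma>"
  unfolding locally_negligible_alt[of \<Gamma>]
proof
  fix p assume "p \<in> \<Gamma>"
  then obtain U \<gamma> \<tau> where U: "open U" "p \<in> U" and \<gamma>: "\<gamma> C1_differentiable_on {-1<..<1}"
    and h: "homeomorphism {-1<..<1} (\<Gamma> \<inter> U) \<gamma> \<tau>"
    using assms unfolding C2_curve_def by blast
  have "\<gamma> differentiable_on {-1<..<1}"
    using \<gamma> by (auto simp: C1_differentiable_on_eq differentiable_on_def intro: differentiable_at_withinI)
  then have "negligible (\<gamma> ` {-1<..<1})" by (intro negligible_differentiable_image_lowdim) simp
  moreover have "\<gamma> ` {-1<..<1} = \<Gamma> \<inter> U" using h by (simp add: homeomorphism_def)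
  ultimately show "\<exists>U. openin (top_of_set \<Gamma>) U \<and> p \<in> U \<and> negligible U"
    using U \<open>p \<in> \<Gamma>\<close> by (intro exI[of _ "\<Gamma> \<inter> U"]) (auto simp: openin_open)
qed

text \<open>Such a set differs from its interior by a null set.\<close>

lemma lebesgue_set_negligible_frontier:
  fixes S :: "'a::euclidean_space set"
  assumes "negligible (frontier S)"
  shows "S \<in> sets lebesgue"
proof -
  have "S = interior S \<union> (S \<inter> frontier S)"
    using interior_subset closure_subset by (auto simp: frontier_def)
  moreover have "S \<inter> frontier S \<in> sets lebesgue"
    using negligible_subset[OF assms] negligible_imp_sets by blast
  moreover have "interior S \<in> sets lebesgue" by (simp add: borel_open)
  ultimately show ?thesis by (metis sets.Un)
qed

lemma test_fun_partial_deriv: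
  assumes "test_fun \<phi>"
  shows "test_fun (partial_deriv i \<phi>)"
proof -
  let ?K = "closure {x. \<phi> x \<noteq> 0}"
  have C: "C_k (Suc k) \<phi>" for k using assms by (auto simp only: test_fun_def)
  have "partial_deriv i \<phi> x = 0" if "x \<notin> ?K" for x
  proof -
    have "(\<phi> has_derivative (\<lambda>_. 0)) (at x)"
      by (rule has_derivative_transform_within_open[where f="\<lambda>_. 0" and s="- ?K"])
        (use that closure_subset[of "{x. \<phi> x \<noteq> 0}"] in auto)
    then show ?thesis by (simp add: partial_deriv_eq)
  qed
  then have "closure {x. partial_deriv i \<phi> x \<noteq> 0} \<subseteq> ?K" by (intro closure_minimal) auto
  moreover have "compact ?K" using assms by (simp add: test_fun_def)
  ultimately have "compact (closure {x. partial_deriv i \<phi> x \<noteq> 0})"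
    using compact_Int_closed[of ?K "closure {x. partial_deriv i \<phi> x \<noteq> 0}"] by (simp add: Int_absorb1)
  then show ?thesis using C by (simp add: test_fun_def)
qed

lemma borel_measurable_lebesgue_test_fun:
  assumes "test_fun \<phi>"
  shows "\<phi> \<in> borel_measurable lebesgue"
proof -
  have "C_k 0 \<phi>" using assms by (auto simp only: test_fun_def)
  then show ?thesis by (auto intro!: measurable_completion borel_measurable_continuous_onI)
qed

lemma integrable_test_fun_square:
  assumes "test_fun \<phi>"
  shows "integrable lebesgue (\<lambda>x. (\<phi> x)\<^sup>2)"
proof -
  let ?K = "closure {x. \<phi> x \<noteq> 0}"
  have "C_k 0 \<phi>" using assms by (auto simp only: test_fun_def)
  then have c: "continuous_on UNIV (\<lambda>x. (\<phi> x)\<^sup>2)" by (auto intro: continuous_intros)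
  have "integrable lborel (\<lambda>x. indicator ?K x *\<^sub>R (\<phi> x)\<^sup>2)"
    using assms c by (intro borel_integrable_compact) (auto simp: test_fun_def intro: continuous_on_subset)
  moreover have "(\<lambda>x. indicator ?K x *\<^sub>R (\<phi> x)\<^sup>2) = (\<lambda>x. (\<phi> x)\<^sup>2)"
    using closure_subset[of "{x. \<phi> x \<noteq> 0}"] by (intro ext) (auto simp: indicator_def)
  ultimately have "integrable lborel (\<lambda>x. (\<phi> x)\<^sup>2)" by simp
  then show ?thesis
    using c by (subst integrable_completion) (auto intro: borel_measurable_continuous_onI)
qed

lemma integrable_mult_L2:
  fixes G :: "'a \<Rightarrow> complex^2" and \<psi> :: "'a \<Rightarrow> real"
  assumes [measurable]: "G \<in> borel_measurable M" "\<psi> \<in> borel_measurable M"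
    and "integrable M (\<lambda>x. (norm (G x))\<^sup>2)" "integrable M (\<lambda>x. (\<psi> x)\<^sup>2)"
  shows "integrable M (\<lambda>x. \<psi> x *\<^sub>R (G x $ i))"
proof (rule Bochner_Integration.integrable_bound)
  show "integrable M (\<lambda>x. (norm (G x))\<^sup>2 + (\<psi> x)\<^sup>2)" using assms by auto
  have "(\<lambda>v::complex^2. v $ i) \<in> borel_measurable borel"
    by (intro borel_measurable_continuous_onI continuous_intros)
  then have "(\<lambda>x. G x $ i) \<in> borel_measurable M" by (rule measurable_compose[rotated]) simp
  then show "(\<lambda>x. \<psi> x *\<^sub>R (G x $ i)) \<in> borel_measurable M" by simp
  show "AE x in M. norm (\<psi> x *\<^sub>R (G x $ i)) \<le> norm ((norm (G x))\<^sup>2 + (\<psi> x)\<^sup>2)"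
  proof (rule AE_I2)
    fix x
    have "norm (\<psi> x *\<^sub>R (G x $ i)) \<le> \<bar>\<psi> x\<bar> * norm (G x)"
      by (simp add: mult_left_mono Finite_Cartesian_Product.norm_nth_le)
    also have "\<dots> \<le> (norm (G x))\<^sup>2 + (\<psi> x)\<^sup>2"
      using sum_squares_bound[of "\<bar>\<psi> x\<bar>" "norm (G x)"] mult_nonneg_nonneg[OF abs_ge_zero[of "\<psi> x"] norm_ge_zero[of "G x"]]
      unfolding power2_abs by linarith
    finally show "norm (\<psi> x *\<^sub>R (G x $ i)) \<le> norm ((norm (G x))\<^sup>2 + (\<psi> x)\<^sup>2)" by simp
  qed
qed

text \<open>Optimizing over the weight \<open>t\<close> turns a family of arithmetic mean bounds into the Cauchy-Schwarz
  inequality, with no square roots of integrals.\<close>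

lemma square_le_product_if_weighted_mean:
  fixes a X Y :: real
  assumes "\<And>t. 0 < t \<Longrightarrow> a \<le> t / 2 * X + Y / (2 * t)" "0 \<le> a" "0 \<le> X" "0 \<le> Y"
  shows "a\<^sup>2 \<le> X * Y"
proof (cases "a = 0 \<or> X = 0")
  case True
  show ?thesis
  proof (cases "a = 0")
    case False
    with True assms(2) have "a > 0" "X = 0" by auto
    with assms(1)[of "(Y + 1) / a"] assms(4) have "a \<le> Y * a / (2 * (Y + 1))" by simp
    also have "\<dots> < a" using \<open>a > 0\<close> assms(4) by (simp add: field_simps add_nonneg_pos)
    finally show ?thesis by simp
  qed (use assms in simp)
next
  case False
  then have "a > 0" "X > 0" using assms by auto
  with assms(1)[of "a / X"] have "a \<le> a / 2 + Y * X / (2 * a)" by simp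
  with \<open>a > 0\<close> show ?thesis by (simp add: field_simps power2_eq_square)
qed

text \<open>Here \<open>w\<close> dominates \<open>\<bar>V\<bar>\<^sup>2\<close> for the vector field
  \<open>V = A \<nabla>\<phi> - (-\<partial>\<^sub>2\<zeta>, \<partial>\<^sub>1\<zeta>) + \<i> \<eta> \<nabla>\<phi>\<close>. The term with \<open>\<zeta>\<close> integrates to zero against
  the gradient of the solution because that gradient is curl-free, so \<open>- f(\<phi>)\<close> is the integral of the bilinear
  product of the gradient with \<open>V\<close>.\<close>

lemma weak_solution_lower_bound:
  fixes A :: "real^2 \<Rightarrow> real" and \<phi> \<zeta> w :: "real^2 \<Rightarrow> real"
  assumes sol: "weak_solution (\<lambda>x. of_real (A x) + \<i> * of_real \<eta>) f u"
    and A: "A \<in> borel_measurable lebesgue" "\<And>x. \<bar>A x\<bar> \<le> 1"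
    and \<phi>: "test_fun \<phi>" and \<zeta>: "test_fun \<zeta>"
    and comm: "partial_deriv 1 (partial_deriv 2 \<zeta>) = partial_deriv 2 (partial_deriv 1 \<zeta>)"
    and w: "integrable lebesgue w"
      "\<And>x. (A x * partial_deriv 1 \<phi> x + partial_deriv 2 \<zeta> x)\<^sup>2 + (A x * partial_deriv 2 \<phi> x - partial_deriv 1 \<zeta> x)\<^sup>2
         + \<eta>\<^sup>2 * ((partial_deriv 1 \<phi> x)\<^sup>2 + (partial_deriv 2 \<phi> x)\<^sup>2) \<le> w x"
  shows "(f \<phi>)\<^sup>2 \<le> (\<integral>x. (norm (weak_grad u x))\<^sup>2 \<partial>lebesgue) * (\<integral>x. w x \<partial>lebesgue)"
proof -
  define G where "G = weak_grad u"
  have u: "u \<in> Hdot1" using sol by (simp add: weak_solution_def)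
  then have "\<exists>G. is_weak_gradient u G" by (simp add: Hdot1_def)
  then have wg: "is_weak_gradient u G" unfolding G_def weak_grad_def by (rule someI_ex)
  have Gm [measurable]: "G \<in> borel_measurable lebesgue" and G2: "integrable lebesgue (\<lambda>x. (norm (G x))\<^sup>2)"
    using u by (simp_all add: Hdot1_def G_def)
  note t = test_fun_partial_deriv[OF \<phi>] test_fun_partial_deriv[OF \<zeta>]
  note [measurable] = t[THEN borel_measurable_lebesgue_test_fun] A(1)
  have int\<zeta>: "integrable lebesgue (\<lambda>x. partial_deriv j \<zeta> x *\<^sub>R (G x $ i))" for i j
    by (intro integrable_mult_L2 Gm G2 integrable_test_fun_square t borel_measurable_lebesgue_test_fun)
  have int\<phi>: "integrable lebesgue (\<lambda>x. partial_deriv j \<phi> x *\<^sub>R (G x $ i))" for i j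
    by (intro integrable_mult_L2 Gm G2 integrable_test_fun_square t borel_measurable_lebesgue_test_fun)
  have intA: "integrable lebesgue (\<lambda>x. (A x * partial_deriv j \<phi> x) *\<^sub>R (G x $ i))" for i j
  proof (intro integrable_mult_L2 Gm G2)
    show "integrable lebesgue (\<lambda>x. (A x * partial_deriv j \<phi> x)\<^sup>2)"
    proof (rule Bochner_Integration.integrable_bound[OF integrable_test_fun_square[OF t(1)[of j]]])
      show "AE x in lebesgue. norm ((A x * partial_deriv j \<phi> x)\<^sup>2) \<le> norm ((partial_deriv j \<phi> x)\<^sup>2)"
      proof (rule AE_I2)
        fix x
        have "(A x)\<^sup>2 \<le> 1" using A(2)[of x] by (simp add: abs_square_le_1)
        then show "norm ((A x * partial_deriv j \<phi> x)\<^sup>2) \<le> norm ((partial_deriv j \<phi> x)\<^sup>2)"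
          by (simp add: power_mult_distrib mult_left_le_one_le)
      qed
    qed measurable
  qed measurable
  have "(\<integral>x. partial_deriv 1 (partial_deriv 2 \<zeta>) x *\<^sub>R u x \<partial>lebesgue) = - (\<integral>x. partial_deriv 2 \<zeta> x *\<^sub>R (G x $ 1) \<partial>lebesgue)"
    "(\<integral>x. partial_deriv 2 (partial_deriv 1 \<zeta>) x *\<^sub>R u x \<partial>lebesgue) = - (\<integral>x. partial_deriv 1 \<zeta> x *\<^sub>R (G x $ 2) \<partial>lebesgue)"
    using wg t(2) unfolding is_weak_gradient_def by blast+
  with comm have curl: "(\<integral>x. partial_deriv 2 \<zeta> x *\<^sub>R (G x $ 1) \<partial>lebesgue) - (\<integral>x. partial_deriv 1 \<zeta> x *\<^sub>R (G x $ 2) \<partial>lebesgue) = 0"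
    by simp
  define Z where "Z x = ((A x * partial_deriv 1 \<phi> x) *\<^sub>R (G x $ 1) + (A x * partial_deriv 2 \<phi> x) *\<^sub>R (G x $ 2))
     + \<i> * of_real \<eta> * (partial_deriv 1 \<phi> x *\<^sub>R (G x $ 1) + partial_deriv 2 \<phi> x *\<^sub>R (G x $ 2))
     + (partial_deriv 2 \<zeta> x *\<^sub>R (G x $ 1) - partial_deriv 1 \<zeta> x *\<^sub>R (G x $ 2))" for x
  have eq: "(\<integral>x. (of_real (A x) + \<i> * of_real \<eta>) * (\<Sum>i\<in>UNIV. G x $ i * of_real (partial_deriv i \<phi> x)) \<partial>lebesgue) = - of_real (f \<phi>)"
    using sol \<phi> by (simp add: weak_solution_def G_def)
  have i1: "integrable lebesgue (\<lambda>x. ((A x * partial_deriv 1 \<phi> x) *\<^sub>R (G x $ 1) + (A x * partial_deriv 2 \<phi> x) *\<^sub>R (G x $ 2))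
     + \<i> * of_real \<eta> * (partial_deriv 1 \<phi> x *\<^sub>R (G x $ 1) + partial_deriv 2 \<phi> x *\<^sub>R (G x $ 2)))"
    by (intro Bochner_Integration.integrable_add integrable_mult_right intA int\<phi>)
  have i2: "integrable lebesgue (\<lambda>x. partial_deriv 2 \<zeta> x *\<^sub>R (G x $ 1) - partial_deriv 1 \<zeta> x *\<^sub>R (G x $ 2))"
    by (intro Bochner_Integration.integrable_diff int\<zeta>)
  have Zint: "integrable lebesgue Z" unfolding Z_def by (rule Bochner_Integration.integrable_add[OF i1 i2])
  have "(\<integral>x. Z x \<partial>lebesgue) = - of_real (f \<phi>) + 0"
    unfolding Z_def Bochner_Integration.integral_add[OF i1 i2] eq[symmetric] curl[symmetric]
      Bochner_Integration.integral_diff[OF int\<zeta> int\<zeta>, symmetric]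
    by (intro arg_cong2[where f="(+)"] Bochner_Integration.integral_cong refl)
      (simp add: sum_2 scaleR_conv_of_real algebra_simps)
  then have fZ: "\<bar>f \<phi>\<bar> = norm (\<integral>x. Z x \<partial>lebesgue)" by simp
  have Zbound: "norm (Z x) \<le> s / 2 * (norm (G x))\<^sup>2 + w x / (2 * s)" if "s > 0" for s x
  proof -
    \<comment> \<open>Real and imaginary parts of \<open>V\<close> are the flux defect and \<open>\<eta> \<nabla>\<phi>\<close>.\<close>
    define V where "V j = (if j = (1::2) then Complex (A x * partial_deriv 1 \<phi> x + partial_deriv 2 \<zeta> x) (\<eta> * partial_deriv 1 \<phi> x)
      else Complex (A x * partial_deriv 2 \<phi> x - partial_deriv 1 \<zeta> x) (\<eta> * partial_deriv 2 \<phi> x))" for j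
    have "Z x = V 1 * (G x $ 1) + V 2 * (G x $ 2)"
      by (simp add: Z_def V_def Complex_eq scaleR_conv_of_real algebra_simps)
    then have "norm (Z x) \<le> norm (V 1) * norm (G x $ 1) + norm (V 2) * norm (G x $ 2)"
      by (metis norm_mult norm_triangle_ineq)
    also have "\<dots> \<le> (s / 2 * (norm (G x $ 1))\<^sup>2 + (norm (V 1))\<^sup>2 / (2 * s)) + (s / 2 * (norm (G x $ 2))\<^sup>2 + (norm (V 2))\<^sup>2 / (2 * s))"
    proof -
      have "a * b \<le> s / 2 * b\<^sup>2 + a\<^sup>2 / (2 * s)" for a b :: real
      proof -
        have "0 \<le> (s * b - a)\<^sup>2 / (2 * s)" using that by simp
        also have "\<dots> = s / 2 * b\<^sup>2 + a\<^sup>2 / (2 * s) - a * b"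
          using that by (simp add: field_simps power2_eq_square)
        finally show ?thesis by simp
      qed
      then show ?thesis by (intro add_mono)
    qed
    also have "\<dots> = s / 2 * ((norm (G x $ 1))\<^sup>2 + (norm (G x $ 2))\<^sup>2) + ((norm (V 1))\<^sup>2 + (norm (V 2))\<^sup>2) / (2 * s)"
      by (simp add: algebra_simps add_divide_distrib)
    also have "(norm (G x $ 1))\<^sup>2 + (norm (G x $ 2))\<^sup>2 = (norm (G x))\<^sup>2"
      by (simp add: norm_vec_def L2_set_def sum_2)
    also have "((norm (V 1))\<^sup>2 + (norm (V 2))\<^sup>2) / (2 * s) \<le> w x / (2 * s)"
      using w(2)[of x] that by (intro divide_right_mono) (simp_all add: V_def cmod_power2 algebra_simps power_mult_distrib)
    finally show ?thesis by simp
  qed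
  have "0 \<le> w x" for x by (rule order_trans[OF _ w(2)[of x]]) simp
  have "\<bar>f \<phi>\<bar>\<^sup>2 \<le> (\<integral>x. (norm (G x))\<^sup>2 \<partial>lebesgue) * (\<integral>x. w x \<partial>lebesgue)"
  proof (rule square_le_product_if_weighted_mean)
    fix s :: real assume "0 < s"
    have "\<bar>f \<phi>\<bar> \<le> (\<integral>x. norm (Z x) \<partial>lebesgue)" unfolding fZ by (rule integral_norm_bound)
    also have "\<dots> \<le> (\<integral>x. s / 2 * (norm (G x))\<^sup>2 + w x / (2 * s) \<partial>lebesgue)"
      using Zint G2 w(1) by (intro integral_mono Zbound \<open>0 < s\<close> Bochner_Integration.integrable_add
          integrable_norm integrable_mult_right integrable_divide)
    also have "\<dots> = s / 2 * (\<integral>x. (norm (G x))\<^sup>2 \<partial>lebesgue) + (\<integral>x. w x \<partial>lebesgue) / (2 * s)"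
      using G2 w(1) by simp
    finally show "\<bar>f \<phi>\<bar> \<le> s / 2 * (\<integral>x. (norm (G x))\<^sup>2 \<partial>lebesgue) + (\<integral>x. w x \<partial>lebesgue) / (2 * s)" .
  qed (use \<open>\<And>x. 0 \<le> w x\<close> in auto)
  then show ?thesis by (simp add: G_def)
qed

section \<open>The flux defect of a smoothed plasmon\<close>

text \<open>Where \<open>g = 1\<close> the two modes are the real and imaginary part of \<open>z^k\<close>. By the Cauchy-Riemann
  equations the flux of the first is the rotated gradient of the second precisely for \<open>a = -1\<close>,
  and the defect is proportional to \<open>a + 1\<close> otherwise.\<close>

lemma flux_defect_inside:
  assumes dg: "\<And>s. (g has_real_derivative g' s) (at s)" and "g ((norm x)\<^sup>2) = 1" "g' ((norm x)\<^sup>2) = 0"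
  shows "(a * partial_deriv 1 (mode_re g k) x + partial_deriv 2 (mode_im g k) x)\<^sup>2
       + (a * partial_deriv 2 (mode_re g k) x - partial_deriv 1 (mode_im g k) x)\<^sup>2
       = (a + 1)\<^sup>2 * (real k)\<^sup>2 * ((norm x)\<^sup>2) ^ (k - 1)"
    and "(partial_deriv 1 (mode_re g k) x)\<^sup>2 + (partial_deriv 2 (mode_re g k) x)\<^sup>2 = (real k)\<^sup>2 * ((norm x)\<^sup>2) ^ (k - 1)"
proof -
  let ?v = "to_complex x ^ (k - 1)"
  have v: "(Re ?v)\<^sup>2 + (Im ?v)\<^sup>2 = ((norm x)\<^sup>2) ^ (k - 1)"
    by (simp only: cmod_power2[symmetric] norm_power cmod_to_complex power_mult[symmetric] mult.commute)
  have p: "partial_deriv 1 (mode_re g k) x = real k * Re ?v" "partial_deriv 2 (mode_re g k) x = - (real k * Im ?v)"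
    "partial_deriv 1 (mode_im g k) x = real k * Im ?v" "partial_deriv 2 (mode_im g k) x = real k * Re ?v"
    using assms(2,3) by (simp_all add: partial_deriv_mode[OF dg] mode_re_def mode_im_def)
  have e: "a * (real k * Re ?v) + real k * Re ?v = (a + 1) * real k * Re ?v"
    "a * (- (real k * Im ?v)) - real k * Im ?v = - ((a + 1) * real k * Im ?v)"
    by (simp_all add: algebra_simps)
  show "(a * partial_deriv 1 (mode_re g k) x + partial_deriv 2 (mode_im g k) x)\<^sup>2
       + (a * partial_deriv 2 (mode_re g k) x - partial_deriv 1 (mode_im g k) x)\<^sup>2
       = (a + 1)\<^sup>2 * (real k)\<^sup>2 * ((norm x)\<^sup>2) ^ (k - 1)"
    unfolding p e v[symmetric] by (simp only: power_mult_distrib power2_minus distrib_left)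
  show "(partial_deriv 1 (mode_re g k) x)\<^sup>2 + (partial_deriv 2 (mode_re g k) x)\<^sup>2 = (real k)\<^sup>2 * ((norm x)\<^sup>2) ^ (k - 1)"
    unfolding p v[symmetric] by (simp only: power_mult_distrib power2_minus distrib_left)
qed

text \<open>In complex notation the gradient of \<open>g Re z^k\<close> minus the rotated gradient
  of \<open>g Im z^k\<close> is \<open>2 (k g + s g') cnj(z)^(k-1)\<close>. The factors \<open>s^(k+1)\<close> bring the
  estimates into the form in which the profile is controlled.\<close>

lemma flux_defect_outside:
  assumes dg: "\<And>s. (g has_real_derivative g' s) (at s)" and "k \<ge> 1" and s: "s = (norm x)\<^sup>2"
  shows "((partial_deriv 1 (mode_re g k) x + partial_deriv 2 (mode_im g k) x)\<^sup>2
       + (partial_deriv 2 (mode_re g k) x - partial_deriv 1 (mode_im g k) x)\<^sup>2) * s ^ (k + 1)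
       = 4 * (\<bar>real k * g s + s * g' s\<bar> * s ^ k)\<^sup>2"
    and "((partial_deriv 1 (mode_re g k) x)\<^sup>2 + (partial_deriv 2 (mode_re g k) x)\<^sup>2) * s ^ (k + 1)
       \<le> 2 * (real k * (g s * s ^ k))\<^sup>2 + 8 * (\<bar>s * g' s\<bar> * s ^ k)\<^sup>2"
proof -
  let ?v = "to_complex x ^ (k - 1)"
  let ?w = "to_complex x ^ k"
  have s0: "0 \<le> s" by (simp add: s)
  have v: "(Re ?v)\<^sup>2 + (Im ?v)\<^sup>2 = s ^ (k - 1)"
    by (simp only: cmod_power2[symmetric] norm_power cmod_to_complex power_mult[symmetric] mult.commute s)
  have "?w = to_complex x * ?v" using \<open>k \<ge> 1\<close> by (cases k) auto
  then have w: "Re ?w = x $ 1 * Re ?v - x $ 2 * Im ?v" "Im ?w = x $ 1 * Im ?v + x $ 2 * Re ?v"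
    by (simp_all add: to_complex_def)
  have s2: "s = (x $ 1)\<^sup>2 + (x $ 2)\<^sup>2"
    by (simp add: s norm_vec_def L2_set_def sum_2)
  have pw: "s ^ (k - 1) * s ^ (k + 1) = (s ^ k)\<^sup>2"
    using \<open>k \<ge> 1\<close> by (cases k) (auto simp: power2_eq_square)
  have "partial_deriv 1 (mode_re g k) x + partial_deriv 2 (mode_im g k) x = 2 * (real k * g s + s * g' s) * Re ?v"
    unfolding partial_deriv_mode[OF dg] mode_re_def mode_im_def s[symmetric] w
    by (simp add: s2 power2_eq_square algebra_simps)
  moreover have "partial_deriv 2 (mode_re g k) x - partial_deriv 1 (mode_im g k) x = - (2 * (real k * g s + s * g' s) * Im ?v)"
    unfolding partial_deriv_mode[OF dg] mode_re_def mode_im_def s[symmetric] w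
    by (simp add: s2 power2_eq_square algebra_simps)
  moreover have "(2 * a * p)\<^sup>2 + (- (2 * a * q))\<^sup>2 = 4 * a\<^sup>2 * (p\<^sup>2 + q\<^sup>2)" for a p q :: real
    by (simp add: power2_eq_square algebra_simps)
  ultimately have "(partial_deriv 1 (mode_re g k) x + partial_deriv 2 (mode_im g k) x)\<^sup>2
       + (partial_deriv 2 (mode_re g k) x - partial_deriv 1 (mode_im g k) x)\<^sup>2 = 4 * (real k * g s + s * g' s)\<^sup>2 * s ^ (k - 1)"
    unfolding v[symmetric] by (simp only:)
  then show "((partial_deriv 1 (mode_re g k) x + partial_deriv 2 (mode_im g k) x)\<^sup>2
       + (partial_deriv 2 (mode_re g k) x - partial_deriv 1 (mode_im g k) x)\<^sup>2) * s ^ (k + 1)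
       = 4 * (\<bar>real k * g s + s * g' s\<bar> * s ^ k)\<^sup>2"
    by (simp only: mult.assoc pw power_mult_distrib power2_abs)
  have wv: "(Re ?w)\<^sup>2 \<le> s * s ^ (k - 1)"
  proof -
    have "(Re ?w)\<^sup>2 \<le> (cmod ?w)\<^sup>2" by (simp add: cmod_power2)
    also have "\<dots> = s ^ k"
      by (simp only: norm_power cmod_to_complex power_mult[symmetric] mult.commute s)
    also have "\<dots> = s * s ^ (k - 1)" using \<open>k \<ge> 1\<close> by (cases k) auto
    finally show ?thesis .
  qed
  have two: "(p + q)\<^sup>2 \<le> 2 * p\<^sup>2 + 2 * q\<^sup>2" for p q :: real
    using sum_squares_bound[of p q] by (simp add: power2_sum)
  have "(partial_deriv 1 (mode_re g k) x)\<^sup>2 + (partial_deriv 2 (mode_re g k) x)\<^sup>2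
    = (real k * g s * Re ?v + 2 * x $ 1 * g' s * Re ?w)\<^sup>2 + (- (real k * g s * Im ?v) + 2 * x $ 2 * g' s * Re ?w)\<^sup>2"
    unfolding partial_deriv_mode[OF dg] mode_re_def mode_im_def s[symmetric] by (simp add: mult.assoc)
  also have "\<dots> \<le> (2 * (real k * g s * Re ?v)\<^sup>2 + 2 * (2 * x $ 1 * g' s * Re ?w)\<^sup>2) + (2 * (- (real k * g s * Im ?v))\<^sup>2 + 2 * (2 * x $ 2 * g' s * Re ?w)\<^sup>2)"
    by (intro add_mono two)
  also have "\<dots> = 2 * (real k * g s)\<^sup>2 * ((Re ?v)\<^sup>2 + (Im ?v)\<^sup>2) + 8 * (g' s)\<^sup>2 * s * (Re ?w)\<^sup>2"
    by (simp add: s2 power_mult_distrib algebra_simps)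
  also have "\<dots> \<le> 2 * (real k * g s)\<^sup>2 * s ^ (k - 1) + 8 * (g' s)\<^sup>2 * s * (s * s ^ (k - 1))"
    unfolding v using s0 by (intro add_left_mono mult_left_mono wv) auto
  also have "\<dots> = (2 * (real k * g s)\<^sup>2 + 8 * (s * g' s)\<^sup>2) * s ^ (k - 1)"
    by (simp add: power_mult_distrib power2_eq_square algebra_simps)
  finally have "((partial_deriv 1 (mode_re g k) x)\<^sup>2 + (partial_deriv 2 (mode_re g k) x)\<^sup>2) * s ^ (k + 1)
    \<le> (2 * (real k * g s)\<^sup>2 + 8 * (s * g' s)\<^sup>2) * s ^ (k - 1) * s ^ (k + 1)"
    using s0 by (intro mult_right_mono) auto
  also have "\<dots> = 2 * (real k * (g s * s ^ k))\<^sup>2 + 8 * (\<bar>s * g' s\<bar> * s ^ k)\<^sup>2"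
    unfolding mult.assoc[of _ "s ^ (k - 1)"] pw by (simp only: power_mult_distrib power2_abs distrib_right mult.assoc)
  finally show "((partial_deriv 1 (mode_re g k) x)\<^sup>2 + (partial_deriv 2 (mode_re g k) x)\<^sup>2) * s ^ (k + 1)
       \<le> 2 * (real k * (g s * s ^ k))\<^sup>2 + 8 * (\<bar>s * g' s\<bar> * s ^ k)\<^sup>2" .
qed

lemma content_cball_scale:
  assumes "0 \<le> r"
  shows "measure lebesgue (cball (0::real^2) r) = r\<^sup>2 * measure lebesgue (ball (0::real^2) 1)"
  using content_ball_conv_unit_ball[OF assms, of "0::real^2"] content_cball_conv_ball[of "0::real^2" r]
  by (simp add: measure_completion)

lemma divide_le_from_mult:
  fixes X T P c :: real
  assumes "X * T \<le> c * P * P" "P \<le> T" "0 \<le> X" "0 < P"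
  shows "X \<le> c * P"
proof -
  have "X * P \<le> X * T" using assms by (intro mult_left_mono) auto
  with assms(1) have "X * P \<le> c * P * P" by linarith
  then show ?thesis using assms(4) by (rule mult_right_le_imp_le)
qed

text \<open>For \<open>\<eta> = R^(-k)\<close> the square of the defect field is bounded by a multiple of \<open>k\<^sup>2\<close> on the
  disk of radius \<open>2 R\<^sup>2\<close>, and by a multiple of \<open>k\<^sup>2 R^(2k)\<close> on the thin layer around the circle of radius \<open>R\<close>, whose
  area is at most a multiple of \<open>R^(-2k)\<close>. So its integral is of order \<open>k\<^sup>2\<close>. The core enters only
  through the bound \<open>s \<le> 1\<close>. On circles of radius \<open>q\<close> in the region between layer and cutoff the mode is as large as the exact
  plasmon.\<close>

lemma trial_functions:
  fixes R :: real and A :: "real^2 \<Rightarrow> real"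
  assumes R: "R > 1" and \<Sigma>: "\<Sigma> \<subseteq> ball 0 1"
    and A1: "\<And>x. x \<notin> ball 0 R \<Longrightarrow> A x = 1"
    and A2: "\<And>x. x \<in> ball 0 R - \<Sigma> \<Longrightarrow> A x = -1"
    and A3: "\<And>x. x \<in> \<Sigma> \<Longrightarrow> A x = 1"
  obtains C where "0 < C"
    "\<And>k. 1 \<le> k \<Longrightarrow> \<exists>\<phi> \<zeta> w. test_fun \<phi> \<and> test_fun \<zeta> \<and>
       partial_deriv 1 (partial_deriv 2 \<zeta>) = partial_deriv 2 (partial_deriv 1 \<zeta>) \<and>
       integrable lebesgue w \<and> (\<integral>x. w x \<partial>lebesgue) \<le> C * (real k)\<^sup>2 \<and>
       (\<forall>x. (A x * partial_deriv 1 \<phi> x + partial_deriv 2 \<zeta> x)\<^sup>2 + (A x * partial_deriv 2 \<phi> x - partial_deriv 1 \<zeta> x)\<^sup>2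
         + ((1 / R) ^ k)\<^sup>2 * ((partial_deriv 1 \<phi> x)\<^sup>2 + (partial_deriv 2 \<phi> x)\<^sup>2) \<le> w x) \<and>
       (\<forall>q. R \<le> q \<and> q \<le> R\<^sup>2 \<longrightarrow> (\<exists>c. R ^ (2 * k) \<le> c * q ^ (2 * k) \<and>
          (\<forall>x\<in>sphere 0 q. \<phi> x = c * Re (to_complex x ^ k))))"
proof -
  obtain K where K: "0 \<le> K" and prof:
    "\<And>k. \<exists>g g' \<delta>. plasmon_profile R K k g g' \<delta>"
    by (rule radial_profile[OF R]) (rule that)
  define \<omega> where "\<omega> = measure lebesgue (ball (0::real^2) 1)"
  have \<omega>: "0 < \<omega>" using content_ball_pos[of 1 "0::real^2"] by (simp add: \<omega>_def measure_completion)
  \<comment> \<open>\<open>c1\<close> bounds the loss term outside the disk, \<open>c2\<close> the flux defect in the layer, \<open>16 K\<^sup>2\<close> the flux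
      defect of the cutoff, and 5 is for the interior: 4 for the core and 1 for the loss term.\<close>
  define c1 where "c1 = 8 + 32 * (1 + K)\<^sup>2"
  define c2 where "c2 = 4 * (4 + 2 * K)\<^sup>2"
  define C0 where "C0 = c1 + c2 + 16 * K\<^sup>2 + 5"
  have cpos: "0 \<le> c1" "0 \<le> c2" "0 \<le> 16 * K\<^sup>2" by (simp_all add: c1_def c2_def)
  have C0: "c1 + 16 * K\<^sup>2 \<le> C0" "c2 \<le> C0" "5 \<le> C0" "0 < C0" "c1 \<le> C0" using cpos unfolding C0_def by linarith+
  have R2: "1 < R\<^sup>2" "R\<^sup>2 < R ^ 4" "R < R\<^sup>2" "R \<le> 2 * R\<^sup>2"
    using R power_strict_increasing[of 1 2 R] by (auto simp: power_strict_increasing one_less_power)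
  have M4: "(2 * R\<^sup>2)\<^sup>2 = 4 * R ^ 4" by (simp add: power_mult_distrib)
  show thesis
  proof (rule that[of "C0 * \<omega> * (4 * R ^ 4 + 1)"])
    show "0 < C0 * \<omega> * (4 * R ^ 4 + 1)" using C0 \<omega> R by (intro mult_pos_pos add_pos_pos) auto
  next
    fix k :: nat assume k: "1 \<le> k"
    obtain g g' \<delta> where "plasmon_profile R K k g g' \<delta>" using prof[of k] by blast
    note H = this[unfolded plasmon_profile_def]
    have g: "C_k1 n g" and dg: "(g has_real_derivative g' s) (at s)" for n s using H by blast+
    have \<delta>: "0 < \<delta>" "\<delta> * R ^ (2 * k) \<le> 1" using H by blast+
    have g_in: "s \<le> R\<^sup>2 \<Longrightarrow> g s = 1" "s \<le> R\<^sup>2 \<Longrightarrow> g' s = 0" for s using H by blast+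
    have g_nonneg: "R\<^sup>2 \<le> s \<Longrightarrow> 0 \<le> g s" and g_le: "R\<^sup>2 \<le> s \<Longrightarrow> g s * s ^ k \<le> 2 * R ^ (2 * k)"
      and g_ge: "R\<^sup>2 \<le> s \<Longrightarrow> s \<le> R ^ 4 \<Longrightarrow> R ^ (2 * k) \<le> g s * s ^ k"
      and g'_le: "R\<^sup>2 \<le> s \<Longrightarrow> \<bar>s * g' s\<bar> * s ^ k \<le> (real k + K) * (2 * R ^ (2 * k))" for s
      using H by blast+
    have far: "R\<^sup>2 + \<delta> \<le> s \<Longrightarrow> \<bar>real k * g s + s * g' s\<bar> * s ^ k \<le> K * (2 * R ^ (2 * k))"
      and mid: "R\<^sup>2 + \<delta> \<le> s \<Longrightarrow> s < R ^ 4 \<Longrightarrow> real k * g s + s * g' s = 0"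
      and g_0: "4 * R ^ 4 \<le> s \<Longrightarrow> g s = 0" "4 * R ^ 4 < s \<Longrightarrow> g' s = 0" for s
      using H by blast+
    define P where "P = R ^ (2 * k)"
    have P: "1 \<le> P" using R by (simp add: P_def)
    define \<rho> where "\<rho> = sqrt (R\<^sup>2 + \<delta>)"
    have \<rho>: "\<rho>\<^sup>2 = R\<^sup>2 + \<delta>" "0 \<le> \<rho>" using \<delta> R2 by (simp_all add: \<rho>_def)
    have "R < \<rho>" using \<rho> \<delta> R by (intro power2_less_imp_less[of R \<rho>]) auto
    have "\<delta> \<le> 1"
    proof -
      have "\<delta> * 1 \<le> \<delta> * R ^ (2 * k)" by (rule mult_left_mono) (use \<delta> P in \<open>auto simp: P_def\<close>)
      then show ?thesis using \<delta>(2) by linarith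
    qed
    define b where "b = C0 * (real k)\<^sup>2"
    have b: "0 \<le> b" using C0 by (simp add: b_def)
    define w where "w x = b * indicator (cball 0 (2 * R\<^sup>2)) x
      + b * P * (indicator (cball 0 \<rho>) x - indicator (ball 0 R) x)" for x :: "real^2"
    have int: "integrable lebesgue (indicator (cball (0::real^2) r) :: _ \<Rightarrow> real)"
      "integrable lebesgue (indicator (ball (0::real^2) r) :: _ \<Rightarrow> real)" for r
      using lmeasurable_cball[of "0::real^2" r] lmeasurable_ball[of "0::real^2" r]
      by (auto simp: fmeasurable_def intro!: integrable_real_indicator)
    have wint: "integrable lebesgue w"
      unfolding w_def by (intro Bochner_Integration.integrable_add integrable_mult_right
          Bochner_Integration.integrable_diff int)
    have "(\<integral>x. w x \<partial>lebesgue) = b * measure lebesgue (cball (0::real^2) (2 * R\<^sup>2))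
        + b * P * (measure lebesgue (cball (0::real^2) \<rho>) - measure lebesgue (ball (0::real^2) R))"
      unfolding w_def using int by simp
    also have "measure lebesgue (ball (0::real^2) R) = measure lebesgue (cball (0::real^2) R)"
      using content_cball_conv_ball[of "0::real^2" R] by (simp add: measure_completion)
    also have "b * measure lebesgue (cball (0::real^2) (2 * R\<^sup>2))
        + b * P * (measure lebesgue (cball (0::real^2) \<rho>) - measure lebesgue (cball (0::real^2) R))
        = b * \<omega> * (4 * R ^ 4 + \<delta> * P)"
    proof -
      have "0 \<le> R" "0 \<le> 2 * R\<^sup>2" using R by auto
      then show ?thesis
        unfolding content_cball_scale[OF \<rho>(2)] content_cball_scale[OF \<open>0 \<le> R\<close>]
          content_cball_scale[OF \<open>0 \<le> 2 * R\<^sup>2\<close>] \<omega>_def[symmetric] M4 \<rho>(1)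
        by (simp add: algebra_simps)
    qed
    also have "\<dots> \<le> b * \<omega> * (4 * R ^ 4 + 1)"
      using b \<omega> \<delta> by (intro mult_left_mono) (auto simp: P_def)
    finally have wle: "(\<integral>x. w x \<partial>lebesgue) \<le> C0 * \<omega> * (4 * R ^ 4 + 1) * (real k)\<^sup>2"
      by (simp add: b_def mult_ac)
    have layer: "0 \<le> b * P * (indicator (cball 0 \<rho>) x - indicator (ball 0 R) x)" for x :: "real^2"
      using \<open>R < \<rho>\<close> b P by (intro mult_nonneg_nonneg) (auto simp: indicator_def)
    have w_ge: "b \<le> w x" if "norm x \<le> 2 * R\<^sup>2" for x
      using layer[of x] that by (simp add: w_def)
    have w_nonneg: "0 \<le> w x" for x using layer[of x] b by (simp add: w_def)
    define \<phi> where "\<phi> = mode_re g k"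
    define \<zeta> where "\<zeta> = mode_im g k"
    define E where "E x = (A x * partial_deriv 1 \<phi> x + partial_deriv 2 \<zeta> x)\<^sup>2 + (A x * partial_deriv 2 \<phi> x - partial_deriv 1 \<zeta> x)\<^sup>2" for x
    define D where "D x = (partial_deriv 1 \<phi> x)\<^sup>2 + (partial_deriv 2 \<phi> x)\<^sup>2" for x
    define e where "e = ((1 / R) ^ k)\<^sup>2"
    have e: "e * P = 1" "0 \<le> e" "e \<le> 1"
      using R by (simp_all add: e_def P_def power_mult[symmetric] power_divide mult.commute)
    have ED: "0 \<le> E x" "0 \<le> D x" for x by (simp_all add: E_def D_def)
    have bound: "E x + e * D x \<le> w x" for x
    proof (cases "norm x < R")
      case True
      define s where "s = (norm x)\<^sup>2"
      have "s \<le> R\<^sup>2" unfolding s_def using True by (intro power_mono) auto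
      note in_eq = flux_defect_inside[OF dg, where x=x and k=k, folded s_def, OF g_in[OF \<open>s \<le> R\<^sup>2\<close>], folded \<phi>_def \<zeta>_def]
      have E_eq: "E x = (A x + 1)\<^sup>2 * (real k)\<^sup>2 * s ^ (k - 1)" and D_eq: "D x = (real k)\<^sup>2 * s ^ (k - 1)"
        unfolding E_def D_def using in_eq by blast+
      have s0: "0 \<le> s" by (simp add: s_def)
      have "s ^ (k - 1) \<le> (R\<^sup>2) ^ (k - 1)" using s0 \<open>s \<le> R\<^sup>2\<close> by (intro power_mono)
      also have "\<dots> \<le> (R\<^sup>2) ^ k" using R2 by (intro power_increasing) auto
      also have "\<dots> = P" by (simp add: P_def power_mult)
      finally have "e * s ^ (k - 1) \<le> e * P" using e by (intro mult_left_mono)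
      then have "(real k)\<^sup>2 * (e * s ^ (k - 1)) \<le> (real k)\<^sup>2 * 1" using e by (intro mult_left_mono) auto
      then have eD: "e * D x \<le> (real k)\<^sup>2" by (simp add: D_eq mult_ac)
      have E_le: "E x \<le> 4 * (real k)\<^sup>2"
      proof (cases "x \<in> \<Sigma>")
        case True
        then have "norm x \<le> 1" using \<Sigma> by auto
        then have "s \<le> 1" unfolding s_def by (intro power_le_one) auto
        then have "s ^ (k - 1) \<le> 1" using s0 by (intro power_le_one)
        then have "4 * (real k)\<^sup>2 * s ^ (k - 1) \<le> 4 * (real k)\<^sup>2 * 1" by (intro mult_left_mono) auto
        then show ?thesis using A3[OF True] by (simp add: E_eq)
      next
        case False
        then have "A x = -1" using True A2 by auto
        then show ?thesis by (simp add: E_eq)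
      qed
      have "5 * (real k)\<^sup>2 \<le> b" unfolding b_def using C0 by (intro mult_right_mono) auto
      then have "E x + e * D x \<le> b" using eD E_le by linarith
      also have "\<dots> \<le> w x" using True R2 by (intro w_ge) auto
      finally show ?thesis .
    next
      case False
      define s where "s = (norm x)\<^sup>2"
      have "R\<^sup>2 \<le> s" unfolding s_def using False R by (intro power_mono) auto
      have s1: "1 \<le> s" using \<open>R\<^sup>2 \<le> s\<close> R2 by linarith
      have "A x = 1" using False by (intro A1) auto
      then have ET: "E x * s ^ (k + 1) = 4 * (\<bar>real k * g s + s * g' s\<bar> * s ^ k)\<^sup>2"
        and DT: "D x * s ^ (k + 1) \<le> 2 * (real k * (g s * s ^ k))\<^sup>2 + 8 * (\<bar>s * g' s\<bar> * s ^ k)\<^sup>2"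
        using flux_defect_outside[OF dg k s_def] by (simp_all add: E_def D_def \<phi>_def \<zeta>_def)
      have "P = (R\<^sup>2) ^ k" by (simp add: P_def power_mult)
      also have "\<dots> \<le> s ^ k" using \<open>R\<^sup>2 \<le> s\<close> by (intro power_mono) auto
      also have "\<dots> \<le> s ^ (k + 1)" using s1 by (intro power_increasing) auto
      finally have PT: "P \<le> s ^ (k + 1)" .
      have k1: "real k + K \<le> real k * (1 + K)" using mult_left_mono[of 1 "real k" K] k K by (simp add: algebra_simps)
      have D_le: "e * D x \<le> c1 * (real k)\<^sup>2"
      proof -
        have "D x * s ^ (k + 1) \<le> 2 * (real k * (2 * P))\<^sup>2 + 8 * ((real k * (1 + K)) * (2 * P))\<^sup>2"
        proof (rule order_trans[OF DT], intro add_mono mult_left_mono power_mono)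
          show "g s * s ^ k \<le> 2 * P" using g_le[OF \<open>R\<^sup>2 \<le> s\<close>] by (simp add: P_def)
          have "(real k + K) * (2 * P) \<le> (real k * (1 + K)) * (2 * P)" using k1 P by (intro mult_right_mono) auto
          then show "\<bar>s * g' s\<bar> * s ^ k \<le> (real k * (1 + K)) * (2 * P)"
            using g'_le[OF \<open>R\<^sup>2 \<le> s\<close>] by (simp add: P_def)
        qed (use g_nonneg[OF \<open>R\<^sup>2 \<le> s\<close>] s1 in auto)
        also have "\<dots> = c1 * (real k)\<^sup>2 * P * P"
          by (simp add: c1_def power_mult_distrib power2_eq_square algebra_simps)
        finally have "D x \<le> c1 * (real k)\<^sup>2 * P"
          using P by (intro divide_le_from_mult[OF _ PT ED(2)]) auto
        then have "e * D x \<le> e * (c1 * (real k)\<^sup>2 * P)" using e by (intro mult_left_mono)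
        also have "\<dots> = c1 * (real k)\<^sup>2 * (e * P)" by simp
        finally show ?thesis using e by simp
      qed
      have Mx: "norm x \<le> 2 * R\<^sup>2" if "s \<le> 4 * R ^ 4"
      proof (rule power2_le_imp_le)
        show "(norm x)\<^sup>2 \<le> (2 * R\<^sup>2)\<^sup>2" using that by (simp only: s_def M4)
      qed simp
      consider "s \<le> R\<^sup>2 + \<delta>" | "R\<^sup>2 + \<delta> \<le> s" "s < R ^ 4" | "R\<^sup>2 + \<delta> \<le> s" "R ^ 4 \<le> s" "s \<le> 4 * R ^ 4" | "4 * R ^ 4 < s"
        by linarith
      then show ?thesis
      proof cases
        case 1
        have "\<bar>real k * g s + s * g' s\<bar> * s ^ k \<le> (real k * g s + \<bar>s * g' s\<bar>) * s ^ k"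
          using g_nonneg[OF \<open>R\<^sup>2 \<le> s\<close>] s1 by (intro mult_right_mono) (auto simp: abs_mult intro: order_trans[OF abs_triangle_ineq])
        also have "\<dots> = real k * (g s * s ^ k) + \<bar>s * g' s\<bar> * s ^ k" by (simp add: algebra_simps)
        also have "\<dots> \<le> real k * (2 * P) + (real k * (1 + K)) * (2 * P)"
        proof (intro add_mono mult_left_mono)
          have "(real k + K) * (2 * P) \<le> (real k * (1 + K)) * (2 * P)" using k1 P by (intro mult_right_mono) auto
          then show "\<bar>s * g' s\<bar> * s ^ k \<le> (real k * (1 + K)) * (2 * P)"
            using g'_le[OF \<open>R\<^sup>2 \<le> s\<close>] by (simp add: P_def)
        qed (use g_le[OF \<open>R\<^sup>2 \<le> s\<close>] in \<open>auto simp: P_def\<close>)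
        also have "\<dots> = (4 + 2 * K) * real k * P" by (simp add: algebra_simps)
        finally have "(\<bar>real k * g s + s * g' s\<bar> * s ^ k)\<^sup>2 \<le> ((4 + 2 * K) * real k * P)\<^sup>2"
          using s1 by (intro power_mono) auto
        then have "E x * s ^ (k + 1) \<le> 4 * ((4 + 2 * K) * real k * P)\<^sup>2" unfolding ET by simp
        also have "\<dots> = c2 * (real k)\<^sup>2 * P * P"
          by (simp add: c2_def power_mult_distrib power2_eq_square)
        finally have "E x \<le> c2 * (real k)\<^sup>2 * P"
          using P by (intro divide_le_from_mult[OF _ PT ED(1)]) auto
        also have "\<dots> \<le> b * P" unfolding b_def using C0 P by (intro mult_right_mono) auto
        finally have E_le: "E x \<le> b * P" .
        have "norm x \<le> \<rho>"
        proof (rule power2_le_imp_le)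
          show "(norm x)\<^sup>2 \<le> \<rho>\<^sup>2" using 1 by (simp only: s_def \<rho>(1))
        qed (rule \<rho>(2))
        moreover have "s \<le> 4 * R ^ 4" using 1 \<open>\<delta> \<le> 1\<close> R2 by linarith
        ultimately have "w x = b + b * P" using False Mx by (simp add: w_def)
        moreover have "c1 * (real k)\<^sup>2 \<le> b" unfolding b_def using C0(5) by (intro mult_right_mono) auto
        ultimately show ?thesis using E_le D_le by linarith
      next
        case 2
        then have "E x * s ^ (k + 1) = 0" unfolding ET by (simp add: mid)
        then have "E x = 0" using s1 by simp
        moreover have "c1 * (real k)\<^sup>2 \<le> b" unfolding b_def using C0(5) by (intro mult_right_mono) auto
        moreover have "b \<le> w x" using 2 R2 by (intro w_ge Mx) auto
        ultimately show ?thesis using D_le by linarith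
      next
        case 3
        have "(\<bar>real k * g s + s * g' s\<bar> * s ^ k)\<^sup>2 \<le> (K * (2 * P))\<^sup>2"
          using far[OF 3(1)] s1 by (intro power_mono) (auto simp: P_def)
        then have "E x * s ^ (k + 1) \<le> 4 * (K * (2 * P))\<^sup>2" unfolding ET by simp
        also have "\<dots> = 16 * K\<^sup>2 * P * P" by (simp add: power2_eq_square)
        finally have "E x * s ^ (k + 1) \<le> 16 * K\<^sup>2 * (P * P)" by simp
        moreover have "P * P \<le> s ^ (k + 1)"
        proof -
          have "P * P = (R ^ 4) ^ k" by (simp add: P_def power_add[symmetric] power_mult[symmetric])
          also have "\<dots> \<le> s ^ k" using 3 by (intro power_mono) auto
          also have "\<dots> \<le> s ^ (k + 1)" using s1 by (intro power_increasing) auto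
          finally show ?thesis .
        qed
        then have "E x * (P * P) \<le> E x * s ^ (k + 1)" using ED by (intro mult_left_mono)
        ultimately have "E x * (P * P) \<le> 16 * K\<^sup>2 * (P * P)" by linarith
        moreover have "0 < P * P" using P by (intro mult_pos_pos) linarith+
        ultimately have "E x \<le> 16 * K\<^sup>2" by (rule mult_right_le_imp_le)
        also have "\<dots> \<le> 16 * K\<^sup>2 * (real k)\<^sup>2" using k by (simp add: mult_le_cancel_left1)
        finally have "E x + e * D x \<le> (c1 + 16 * K\<^sup>2) * (real k)\<^sup>2" using D_le by (simp add: algebra_simps)
        also have "\<dots> \<le> b" unfolding b_def using C0 by (intro mult_right_mono) auto
        also have "\<dots> \<le> w x" using 3 by (intro w_ge Mx)
        finally show ?thesis .
      next
        case 4
        define T where "T = s ^ (k + 1)"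
        have "0 < T" using s1 by (simp add: T_def)
        have "E x * T = 0" "D x * T \<le> 0" using ET DT g_0 4 by (simp_all add: T_def)
        moreover have "0 \<le> D x * T" using ED(2)[of x] \<open>0 < T\<close> by (intro mult_nonneg_nonneg) auto
        ultimately have "D x * T = 0" by linarith
        with \<open>E x * T = 0\<close> \<open>0 < T\<close> have "E x = 0" "D x = 0" by simp_all
        then show ?thesis using w_nonneg by simp
      qed
    qed
    have tf: "test_fun \<phi>" "test_fun \<zeta>"
      unfolding \<phi>_def \<zeta>_def using g g_0 M4 R
      by (intro test_fun_mode[where M="2 * R\<^sup>2"]; simp)+
    obtain g'' where g'': "\<And>s. (g' has_real_derivative g'' s) (at s)"
      using C_k1_derivative[OF g dg, of "Suc 0"] by auto
    have comm: "partial_deriv 1 (partial_deriv 2 \<zeta>) = partial_deriv 2 (partial_deriv 1 \<zeta>)"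
      unfolding \<zeta>_def by (rule partial_deriv_mode_commute[OF dg g''])
    have val: "\<exists>c. R ^ (2 * k) \<le> c * q ^ (2 * k) \<and> (\<forall>x\<in>sphere 0 q. \<phi> x = c * Re (to_complex x ^ k))"
      if "R \<le> q" "q \<le> R\<^sup>2" for q
    proof (intro exI conjI ballI)
      have "R\<^sup>2 \<le> q\<^sup>2" using that R by (intro power_mono) auto
      moreover have "q\<^sup>2 \<le> (R\<^sup>2)\<^sup>2" using that R by (intro power_mono) auto
      ultimately show "R ^ (2 * k) \<le> g (q\<^sup>2) * q ^ (2 * k)"
        using g_ge[of "q\<^sup>2"] by (simp add: power_mult[symmetric])
      fix x :: "real^2" assume "x \<in> sphere 0 q"
      then show "\<phi> x = g (q\<^sup>2) * Re (to_complex x ^ k)" by (simp add: \<phi>_def mode_re_def)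
    qed
    show "\<exists>\<phi> \<zeta> w. test_fun \<phi> \<and> test_fun \<zeta> \<and>
       partial_deriv 1 (partial_deriv 2 \<zeta>) = partial_deriv 2 (partial_deriv 1 \<zeta>) \<and>
       integrable lebesgue w \<and> (\<integral>x. w x \<partial>lebesgue) \<le> C0 * \<omega> * (4 * R ^ 4 + 1) * (real k)\<^sup>2 \<and>
       (\<forall>x. (A x * partial_deriv 1 \<phi> x + partial_deriv 2 \<zeta> x)\<^sup>2 + (A x * partial_deriv 2 \<phi> x - partial_deriv 1 \<zeta> x)\<^sup>2
         + ((1 / R) ^ k)\<^sup>2 * ((partial_deriv 1 \<phi> x)\<^sup>2 + (partial_deriv 2 \<phi> x)\<^sup>2) \<le> w x) \<and>
       (\<forall>q. R \<le> q \<and> q \<le> R\<^sup>2 \<longrightarrow> (\<exists>c. R ^ (2 * k) \<le> c * q ^ (2 * k) \<and>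
          (\<forall>x\<in>sphere 0 q. \<phi> x = c * Re (to_complex x ^ k))))"
      using tf comm wint wle bound[unfolded E_def D_def e_def] val by blast
  qed
qed

section \<open>Resonance\<close>

text \<open>The sixth power collects \<open>k\<^sup>4\<close> from the squared coefficient of the source and \<open>k\<^sup>2\<close> from the defect.\<close>

lemma exponential_over_power_at_top:
  fixes b :: real
  assumes "1 < b" "0 < c"
  shows "filterlim (\<lambda>k::nat. c * b ^ k / real k ^ 6) at_top sequentially"
proof -
  define m where "m = root 6 b"
  have m: "1 < m" "m ^ 6 = b" using assms by (auto simp: m_def)
  have "(\<lambda>k. (of_nat k / m ^ k) ^ 6 / c) \<longlonglongrightarrow> 0 ^ 6 / c"
    using m(1) assms(2) by (intro tendsto_intros lim_n_over_pown) auto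
  moreover have "\<forall>\<^sub>F k in sequentially. 0 < (of_nat k / m ^ k) ^ 6 / c"
    using eventually_gt_at_top[of 0] by eventually_elim (use m assms in auto)
  ultimately have "filterlim (\<lambda>k. inverse ((of_nat k / m ^ k) ^ 6 / c)) at_top sequentially"
    by (intro filterlim_inverse_at_top) auto
  moreover have "inverse ((of_nat k / m ^ k) ^ 6 / c) = c * b ^ k / real k ^ 6" for k :: nat
    by (simp add: m(2)[symmetric] power_divide power_mult[symmetric] mult.commute)
  ultimately show ?thesis by simp
qed

lemma Limsup_at_right_infinity_if_sequence:
  fixes f :: "real \<Rightarrow> real"
  assumes "filterlim h (at_right 0) sequentially" "filterlim (\<lambda>k. f (h k)) at_top sequentially"
  shows "Limsup (at_right 0) (\<lambda>\<eta>. ereal (f \<eta>)) = \<infinity>"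
proof (rule ccontr)
  assume "\<not> ?thesis"
  then obtain B :: real where B: "Limsup (at_right 0) (\<lambda>\<eta>. ereal (f \<eta>)) < ereal B"
    using less_PInf_Ex_of_nat[of "Limsup (at_right 0) (\<lambda>\<eta>. ereal (f \<eta>))"] by auto
  have "\<forall>\<^sub>F \<eta> in at_right 0. f \<eta> < B" using Limsup_lessD[OF B] by simp
  then have "\<forall>\<^sub>F k in sequentially. f (h k) < B"
    using assms(1) unfolding filterlim_iff by blast
  moreover have "\<forall>\<^sub>F k in sequentially. B \<le> f (h k)"
    using assms(2) unfolding filterlim_at_top by blast
  ultimately have "\<forall>\<^sub>F k::nat in sequentially. False" by eventually_elim simp
  then show False by simp
qed

theorem theorem3p4:
  fixes R q :: real and \<Sigma> :: "(real^2) set" and A :: "real^2 \<Rightarrow> real"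
  assumes "R > 1"
    and "\<Sigma> \<subseteq> ball 0 1"
    and "C2_curve (frontier \<Sigma>)"
    and "\<And>x. x \<notin> ball 0 R \<Longrightarrow> A x = 1"
    and "\<And>x. x \<in> ball 0 R - \<Sigma> \<Longrightarrow> A x = -1"
    and "\<And>x. x \<in> \<Sigma> \<Longrightarrow> A x = 1"
    and "R < q" and "q < R powr (3/2)"
  shows "\<exists>F :: real^2 \<Rightarrow> real.
      F \<in> borel_measurable (restrict_space hausdorff1 (sphere 0 q)) \<and>
      integrable (restrict_space hausdorff1 (sphere 0 q)) (\<lambda>x. (F x)\<^sup>2) \<and>
      (\<integral>x. F x \<partial>(restrict_space hausdorff1 (sphere 0 q))) = 0 \<and>
      resonant A (curve_source (sphere 0 q) F)"
proof (intro exI conjI)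
  have q: "0 < q" using assms by simp
  show "source q \<in> borel_measurable (arc_measure q)"
    by (rule measurable_arc_measure[OF borel_measurable_source])
  show "integrable (arc_measure q) (\<lambda>x. (source q x)\<^sup>2)" by (rule integrable_source_square[OF q])
  show "(\<integral>x. source q x \<partial>arc_measure q) = 0" using integral_source_Re_power[OF q, of 0] by simp
  define L where "L = measure (arc_measure q) (sphere 0 q)"
  have L: "0 < L" unfolding L_def by (rule measure_arc_measure_pos[OF q])
  have "q\<^sup>2 < (R powr (3/2))\<^sup>2" using assms q by (intro power_strict_mono) auto
  also have "\<dots> = R powr 3" using assms(1) by (simp add: powr_power)
  also have "\<dots> = R ^ 3" using assms(1) by (simp add: powr_numeral)
  finally have qR: "q\<^sup>2 < R ^ 3" .
  also have "R ^ 3 \<le> (R\<^sup>2)\<^sup>2" using assms(1) by (simp add: power_mult[symmetric] power_increasing)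
  finally have "q\<^sup>2 < (R\<^sup>2)\<^sup>2" .
  then have qR2: "q \<le> R\<^sup>2" by (rule power2_le_imp_le[OF less_imp_le]) simp
  have "\<Sigma> \<in> sets lebesgue"
    by (rule lebesgue_set_negligible_frontier[OF negligible_C2_curve[OF assms(3)]])
  moreover have A_eq: "A = (\<lambda>x. if x \<in> \<Sigma> then 1 else if x \<in> ball 0 R then -1 else 1)"
    using assms(4-6) by auto
  ultimately have A: "A \<in> borel_measurable lebesgue"
    unfolding A_eq by (intro measurable_If_set) auto
  have A_le: "\<bar>A x\<bar> \<le> 1" for x by (auto simp: A_eq)
  obtain C where C: "0 < C" and trial:
    "\<And>k. 1 \<le> k \<Longrightarrow> \<exists>\<phi> \<zeta> w. test_fun \<phi> \<and> test_fun \<zeta> \<and>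
       partial_deriv 1 (partial_deriv 2 \<zeta>) = partial_deriv 2 (partial_deriv 1 \<zeta>) \<and>
       integrable lebesgue w \<and> (\<integral>x. w x \<partial>lebesgue) \<le> C * (real k)\<^sup>2 \<and>
       (\<forall>x. (A x * partial_deriv 1 \<phi> x + partial_deriv 2 \<zeta> x)\<^sup>2 + (A x * partial_deriv 2 \<phi> x - partial_deriv 1 \<zeta> x)\<^sup>2
         + ((1 / R) ^ k)\<^sup>2 * ((partial_deriv 1 \<phi> x)\<^sup>2 + (partial_deriv 2 \<phi> x)\<^sup>2) \<le> w x) \<and>
       (\<forall>q. R \<le> q \<and> q \<le> R\<^sup>2 \<longrightarrow> (\<exists>c. R ^ (2 * k) \<le> c * q ^ (2 * k) \<and>
          (\<forall>x\<in>sphere 0 q. \<phi> x = c * Re (to_complex x ^ k))))"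
    by (rule trial_functions[OF assms(1,2,4,5,6)]) (assumption+, rule that)
  show "resonant A (curve_source (sphere 0 q) (source q))"
    unfolding resonant_def
  proof (intro allI impI)
    fix u assume sol: "\<forall>\<eta>>0. weak_solution (\<lambda>x. complex_of_real (A x) + \<i> * complex_of_real \<eta>)
      (curve_source (sphere 0 q) (source q)) (u \<eta>)"
    have energy: "L\<^sup>2 / (8 * C) * (R ^ 3 / q\<^sup>2) ^ k / real k ^ 6 \<le> energy ((1 / R) ^ k) (u ((1 / R) ^ k))"
      if k: "1 \<le> k" for k
    proof -
      \<comment> \<open>This \<open>\<eta>\<close> balances the loss term, of size \<open>\<eta> k R^k\<close>, against the flux defect of the core, of size \<open>k\<close>.\<close>
      define \<eta> where "\<eta> = (1 / R) ^ k"
      have \<eta>: "0 < \<eta>" using assms(1) by (simp add: \<eta>_def)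
      define X where "X = (\<integral>x. (norm (weak_grad (u \<eta>) x))\<^sup>2 \<partial>lebesgue)"
      have X: "0 \<le> X" by (simp add: X_def)
      obtain \<phi> \<zeta> w c where tf: "test_fun \<phi>" "test_fun \<zeta>"
        "partial_deriv 1 (partial_deriv 2 \<zeta>) = partial_deriv 2 (partial_deriv 1 \<zeta>)"
        "integrable lebesgue w" "(\<integral>x. w x \<partial>lebesgue) \<le> C * (real k)\<^sup>2"
        "\<And>x. (A x * partial_deriv 1 \<phi> x + partial_deriv 2 \<zeta> x)\<^sup>2 + (A x * partial_deriv 2 \<phi> x - partial_deriv 1 \<zeta> x)\<^sup>2
         + \<eta>\<^sup>2 * ((partial_deriv 1 \<phi> x)\<^sup>2 + (partial_deriv 2 \<phi> x)\<^sup>2) \<le> w x"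
        and c: "R ^ (2 * k) \<le> c * q ^ (2 * k)" "\<And>x. x \<in> sphere 0 q \<Longrightarrow> \<phi> x = c * Re (to_complex x ^ k)"
        using trial[OF k] assms(7) qR2 unfolding \<eta>_def by (metis less_imp_le)
      define f where "f = curve_source (sphere 0 q) (source q) \<phi>"
      have "f = (\<integral>x. c * (source q x * Re (to_complex x ^ k)) \<partial>arc_measure q)"
        unfolding f_def curve_source_def by (intro Bochner_Integration.integral_cong) (auto simp: c(2))
      also have "\<dots> = c * (q ^ k / (2 * (real k)\<^sup>2) * L)"
        using k by (simp add: integral_source_Re_power[OF q] L_def)
      also have "\<dots> = (c * q ^ (2 * k)) * (L / (2 * (real k)\<^sup>2 * q ^ k))"
      proof -
        have "c * (Q / (2 * m) * L) = (c * (Q * Q)) * (L / (2 * m * Q))" if "Q \<noteq> 0" for Q m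
          using that by (simp add: divide_simps)
        from this[of "q ^ k" "(real k)\<^sup>2"] q show ?thesis by (simp only: mult_2 power_add) simp
      qed
      also have "\<dots> \<ge> R ^ (2 * k) * (L / (2 * (real k)\<^sup>2 * q ^ k))"
        using c(1) L q by (intro mult_right_mono) auto
      finally have f: "R ^ (2 * k) * (L / (2 * (real k)\<^sup>2 * q ^ k)) \<le> f" .
      have "(R ^ (2 * k) * (L / (2 * (real k)\<^sup>2 * q ^ k)))\<^sup>2 \<le> f\<^sup>2"
        using f L q assms(1) by (intro power_mono) auto
      also have "f\<^sup>2 \<le> X * (\<integral>x. w x \<partial>lebesgue)"
        unfolding f_def X_def using sol \<eta> by (intro weak_solution_lower_bound[OF _ A A_le tf(1-4,6)]) blast
      also have "\<dots> \<le> X * (C * (real k)\<^sup>2)" using X tf(5) by (intro mult_left_mono)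
      finally have "(R ^ (2 * k) * (L / (2 * (real k)\<^sup>2 * q ^ k)))\<^sup>2 / (C * (real k)\<^sup>2) \<le> X"
        using C k by (simp add: divide_le_eq)
      then have "\<eta> / 2 * ((R ^ (2 * k) * (L / (2 * (real k)\<^sup>2 * q ^ k)))\<^sup>2 / (C * (real k)\<^sup>2)) \<le> energy \<eta> (u \<eta>)"
        unfolding energy_def X_def[symmetric] using \<eta> by (intro mult_left_mono) auto
      moreover have "\<eta> / 2 * ((R ^ (2 * k) * (L / (2 * (real k)\<^sup>2 * q ^ k)))\<^sup>2 / (C * (real k)\<^sup>2))
          = L\<^sup>2 / (8 * C) * (R ^ 3 / q\<^sup>2) ^ k / real k ^ 6"
      proof -
        have "(R ^ (2 * k))\<^sup>2 = R ^ k * (R ^ 3) ^ k" "(q ^ k)\<^sup>2 = (q\<^sup>2) ^ k"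
          by (simp_all add: power_mult[symmetric] power_add[symmetric] mult.commute)
        moreover have "\<eta> * R ^ k = 1" using assms(1) by (simp add: \<eta>_def power_mult_distrib[symmetric])
        ultimately have "\<eta> * (R ^ (2 * k))\<^sup>2 = (R ^ 3) ^ k" by (simp add: mult.assoc[symmetric])
        then have "\<eta> / 2 * ((R ^ (2 * k) * (L / (2 * (real k)\<^sup>2 * q ^ k)))\<^sup>2 / (C * (real k)\<^sup>2))
           = (R ^ 3) ^ k / 2 * ((L / (2 * (real k)\<^sup>2 * q ^ k))\<^sup>2 / (C * (real k)\<^sup>2))"
          unfolding power_mult_distrib[of "R ^ (2 * k)"] by (simp add: mult.assoc[symmetric])
        also have "\<dots> = L\<^sup>2 / (8 * C) * (R ^ 3 / q\<^sup>2) ^ k / real k ^ 6"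
          unfolding power_divide[of "R ^ 3"] \<open>(q ^ k)\<^sup>2 = (q\<^sup>2) ^ k\<close>[symmetric]
          using k q C by (simp add: power_divide power_mult_distrib power_mult[symmetric] field_simps)
        finally show ?thesis .
      qed
      ultimately show ?thesis by (simp add: \<eta>_def)
    qed
    show "Limsup (at_right 0) (\<lambda>\<eta>. ereal (energy \<eta> (u \<eta>))) = \<infinity>"
    proof (rule Limsup_at_right_infinity_if_sequence[where h="\<lambda>k. (1 / R) ^ k"])
      show "filterlim (\<lambda>k. (1 / R) ^ k) (at_right 0) sequentially"
        unfolding filterlim_at using assms(1) by (auto intro!: LIMSEQ_power_zero)
      have "filterlim (\<lambda>k::nat. L\<^sup>2 / (8 * C) * (R ^ 3 / q\<^sup>2) ^ k / real k ^ 6) at_top sequentially"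
        using qR q L C by (intro exponential_over_power_at_top) auto
      then show "filterlim (\<lambda>k. energy ((1 / R) ^ k) (u ((1 / R) ^ k))) at_top sequentially"
        by (rule filterlim_at_top_mono) (rule eventually_mono[OF eventually_ge_at_top[of 1] energy])
    qed
  qed
qed

end
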